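(* Let $\mathbb{L}$ be a layer system over a signature $\mathcal{F}$ and let $\mathcal{R}$ be a TRS over $\mathcal{F}$ that is weakly layered according to $\mathbb{L}$ and confluent on the terms of rank one, i.e. on $\mathbb{L}\cap\mathcal{T}(\mathcal{F},\mathcal{V})$. If $\mathcal{R}$ is left-linear then $\mathcal{R}$ is confluent.
   Context: Let $\mathcal{F}$ be a signature and $\mathcal{V}$ a countably infinite set of variables. Let $\square\notin\mathcal{F}\cup\mathcal{V}$ be a fresh constant (the hole). Contexts are the elements of $\mathcal{C}(\mathcal{F},\mathcal{V})=\mathcal{T}(\mathcal{F}\cup\{\square\},\mathcal{V})$; they may contain any number of holes. The order $\sqsubseteq$ on contexts is the smallest reflexive, transitive relation that is monotone (closed under contexts) and satisfies $\square\sqsubseteq C$ for all contexts $C$. The partial operation $C\sqcup D$ is the least upper bound with respect to $\sqsubseteq$, when it exists. For a context $C$, $\mathrm{Pos}_{\mathcal{F}}(C)$ (resp. $\mathrm{Pos}_\square(C)$) denotes the set of positions of $C$ carrying a symbol of $\mathcal{F}$ (resp. the hole). $C|_p$ is the subterm at position $p$ and $C[D]_p$ denotes replacement at $p$. Rewrite rules $\ell\to r$ satisfy $\ell\notin\mathcal{V}$ and $\mathrm{Var}(r)\subseteq\mathrm{Var}(\ell)$. Rewriting is extended to contexts by treating $\square$ as a constant. $s\to_{p,\ell\to r}t$ denotes a rewrite step at position $p$ with rule $\ell\to r$. Given $\mathbb{L}\subseteq\mathcal{C}(\mathcal{F},\mathcal{V})$, a top of a context $C$ is any $L\in\mathbb{L}$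 with $L\sqsubseteq C$. A max-top of $C$ is a top of $C$ that is maximal with respect to $\sqsubseteq$ among the tops of $C$. $\mathbb{L}$ is a layer system if it satisfies the following three conditions. (L1) Every term in $\mathcal{T}(\mathcal{F},\mathcal{V})$ has a top different from $\square$. (L2) For every $x\in\mathcal{V}$, context $C$ and position $p$: $C[x]_p\in\mathbb{L}$ if and only if $C[\square]_p\in\mathbb{L}$. (L3) If $L,N\in\mathbb{L}$, $p\in\mathrm{Pos}_{\mathcal{F}}(L)$ and $L|_p\sqcup N$ is defined, then $L[L|_p\sqcup N]_p\in\mathbb{L}$. A TRS $\mathcal{R}$ over $\mathcal{F}$ is weakly layered according to $\mathbb{L}$ if every rule $\ell\to r\in\mathcal{R}$ satisfies condition (W). (W) Whenever $M$ is a max-top of a term $s$, $p\in\mathrm{Pos}_{\mathcal{F}}(M)$ and $s\to_{p,\ell\to r}t$, then $M\to_{p,\ell\to r}L$ for some $L\in\mathbb{L}$. A relation is confluent on a set $S$ of terms if $S$ is closed under the relation and the restriction of the relation to $S\times S$ is confluent. *)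

theory Defs
  imports Main "HOL-Library.Countable" "HOL-Library.Confluence"
begin

text \<open>
  One datatype covers terms and contexts: \<open>Hole\<close> is the fresh constant \<open>\<box>\<close>. A signature is a set
  of pairs \<open>(f, n)\<close>; the function symbol proper is the pair, with \<open>n\<close> its arity. The set of
  variables is the whole type \<open>'v\<close>.
\<close>

datatype ('f, 'v) mctxt =
  Hole
| Var 'v
| Fun 'f "('f, 'v) mctxt list"

inductive_set contexts :: "('f \<times> nat) set \<Rightarrow> ('f, 'v) mctxt set" for F where
  "Hole \<in> contexts F"
| "Var x \<in> contexts F"
| "(f, length ts) \<in> F \<Longrightarrow> (\<And>t. t \<in> set ts \<Longrightarrow> t \<in> contexts F) \<Longrightarrow> Fun f ts \<in> contexts F"

inductive_set terms :: "('f \<times> nat) set \<Rightarrow> ('f, 'v) mctxt set" for F where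
  "Var x \<in> terms F"
| "(f, length ts) \<in> F \<Longrightarrow> (\<And>t. t \<in> set ts \<Longrightarrow> t \<in> terms F) \<Longrightarrow> Fun f ts \<in> terms F"

fun vars :: "('f, 'v) mctxt \<Rightarrow> 'v set" where
  "vars Hole = {}"
| "vars (Var x) = {x}"
| "vars (Fun f ts) = (\<Union>t\<in>set ts. vars t)"

lemma size_nth_less [termination_simp]:
  "i < length ts \<Longrightarrow> size (ts ! i) < Suc (size_list size ts)"
  using size_list_estimation'[of "ts ! i" ts "size (ts ! i)" size] by (simp add: less_Suc_eq_le)

text \<open>Positions are lists of argument indices, counted from 0.\<close>

fun poss :: "('f, 'v) mctxt \<Rightarrow> nat list set" where
  "poss Hole = {[]}"
| "poss (Var x) = {[]}"
| "poss (Fun f ts) = {[]} \<union> (\<Union>i\<in>{..<length ts}. {i # p | p. p \<in> poss (ts ! i)})"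

text \<open>The last two functions are meaningful only for positions \<open>p \<in> poss C\<close>.\<close>

fun subt_at :: "('f, 'v) mctxt \<Rightarrow> nat list \<Rightarrow> ('f, 'v) mctxt" where
  "subt_at C [] = C"
| "subt_at (Fun f ts) (i # p) = subt_at (ts ! i) p"
| "subt_at C (i # p) = C"

fun replace_at :: "('f, 'v) mctxt \<Rightarrow> nat list \<Rightarrow> ('f, 'v) mctxt \<Rightarrow> ('f, 'v) mctxt" where
  "replace_at C [] D = D"
| "replace_at (Fun f ts) (i # p) D = Fun f (ts[i := replace_at (ts ! i) p D])"
| "replace_at C (i # p) D = C"

definition fun_poss :: "('f, 'v) mctxt \<Rightarrow> nat list set" where
  "fun_poss C = {p \<in> poss C. \<exists>f ts. subt_at C p = Fun f ts}"

inductive ctxt_le :: "('f \<times> nat) set \<Rightarrow> ('f, 'v) mctxt \<Rightarrow> ('f, 'v) mctxt \<Rightarrow> bool" for F where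
  hole: "C \<in> contexts F \<Longrightarrow> ctxt_le F Hole C"
| refl: "C \<in> contexts F \<Longrightarrow> ctxt_le F C C"
| trans: "ctxt_le F C D \<Longrightarrow> ctxt_le F D E \<Longrightarrow> ctxt_le F C E"
| mono: "ctxt_le F C D \<Longrightarrow> E \<in> contexts F \<Longrightarrow> p \<in> poss E \<Longrightarrow>
    ctxt_le F (replace_at E p C) (replace_at E p D)"

text \<open>\<open>is_join F C D E\<close>: the partial operation \<open>C \<squnion> D\<close> is defined and has value \<open>E\<close>.\<close>

definition is_join ::
  "('f \<times> nat) set \<Rightarrow> ('f, 'v) mctxt \<Rightarrow> ('f, 'v) mctxt \<Rightarrow> ('f, 'v) mctxt \<Rightarrow> bool" where
  "is_join F C D E \<longleftrightarrow> ctxt_le F C E \<and> ctxt_le F D E \<and>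
    (\<forall>E'. ctxt_le F C E' \<and> ctxt_le F D E' \<longrightarrow> ctxt_le F E E')"

fun subst :: "('v \<Rightarrow> ('f, 'v) mctxt) \<Rightarrow> ('f, 'v) mctxt \<Rightarrow> ('f, 'v) mctxt" where
  "subst \<sigma> Hole = Hole"
| "subst \<sigma> (Var x) = \<sigma> x"
| "subst \<sigma> (Fun f ts) = Fun f (map (subst \<sigma>) ts)"

type_synonym ('f, 'v) rule = "('f, 'v) mctxt \<times> ('f, 'v) mctxt"

definition trs :: "('f \<times> nat) set \<Rightarrow> ('f, 'v) rule set \<Rightarrow> bool" where
  "trs F R \<longleftrightarrow> (\<forall>(l, r) \<in> R. l \<in> terms F \<and> r \<in> terms F \<and> (\<nexists>x. l = Var x) \<and> vars r \<subseteq> vars l)"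

text \<open>
  No restriction on \<open>\<sigma>\<close> is needed: for rules of a TRS, the variables of \<open>r\<close> occur in \<open>l\<close>, so their
  images are subterms of \<open>s\<close>. Hence a step starting from a term (context) over \<open>F\<close> ends in one.
\<close>

definition rstep_at ::
  "nat list \<Rightarrow> ('f, 'v) rule \<Rightarrow> ('f, 'v) mctxt \<Rightarrow> ('f, 'v) mctxt \<Rightarrow> bool" where
  "rstep_at p rl s t \<longleftrightarrow> p \<in> poss s \<and>
    (\<exists>\<sigma>. subt_at s p = subst \<sigma> (fst rl) \<and> t = replace_at s p (subst \<sigma> (snd rl)))"

definition rstep :: "('f, 'v) rule set \<Rightarrow> ('f, 'v) mctxt \<Rightarrow> ('f, 'v) mctxt \<Rightarrow> bool" where
  "rstep R s t \<longleftrightarrow> (\<exists>p. \<exists>rl \<in> R. rstep_at p rl s t)"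

definition linear_term :: "('f, 'v) mctxt \<Rightarrow> bool" where
  "linear_term t \<longleftrightarrow> (\<forall>x. \<forall>p \<in> poss t. \<forall>q \<in> poss t.
    subt_at t p = Var x \<and> subt_at t q = Var x \<longrightarrow> p = q)"

definition left_linear :: "('f, 'v) rule set \<Rightarrow> bool" where
  "left_linear R \<longleftrightarrow> (\<forall>(l, r) \<in> R. linear_term l)"

definition confluent_on :: "'a set \<Rightarrow> ('a \<Rightarrow> 'a \<Rightarrow> bool) \<Rightarrow> bool" where
  "confluent_on S rel \<longleftrightarrow> (\<forall>s t. s \<in> S \<and> rel s t \<longrightarrow> t \<in> S) \<and>
    confluentp (\<lambda>s t. s \<in> S \<and> t \<in> S \<and> rel s t)"

definition is_top ::
  "('f \<times> nat) set \<Rightarrow> ('f, 'v) mctxt set \<Rightarrow> ('f, 'v) mctxt \<Rightarrow> ('f, 'v) mctxt \<Rightarrow> bool" where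
  "is_top F \<L> C L \<longleftrightarrow> L \<in> \<L> \<and> ctxt_le F L C"

definition is_max_top ::
  "('f \<times> nat) set \<Rightarrow> ('f, 'v) mctxt set \<Rightarrow> ('f, 'v) mctxt \<Rightarrow> ('f, 'v) mctxt \<Rightarrow> bool" where
  "is_max_top F \<L> C M \<longleftrightarrow> is_top F \<L> C M \<and>
    (\<forall>L. is_top F \<L> C L \<and> ctxt_le F M L \<longrightarrow> L = M)"

definition layer_system :: "('f \<times> nat) set \<Rightarrow> ('f, 'v) mctxt set \<Rightarrow> bool" where
  "layer_system F \<L> \<longleftrightarrow>
    \<L> \<subseteq> contexts F \<and>
    \<comment> \<open>L1\<close>
    (\<forall>t \<in> terms F. \<exists>L. is_top F \<L> t L \<and> L \<noteq> Hole) \<and>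
    \<comment> \<open>L2\<close>
    (\<forall>x. \<forall>C \<in> contexts F. \<forall>p \<in> poss C.
      replace_at C p (Var x) \<in> \<L> \<longleftrightarrow> replace_at C p Hole \<in> \<L>) \<and>
    \<comment> \<open>L3\<close>
    (\<forall>L \<in> \<L>. \<forall>N \<in> \<L>. \<forall>p \<in> fun_poss L. \<forall>E.
      is_join F (subt_at L p) N E \<longrightarrow> replace_at L p E \<in> \<L>)"

definition weakly_layered ::
  "('f \<times> nat) set \<Rightarrow> ('f, 'v) mctxt set \<Rightarrow> ('f, 'v) rule set \<Rightarrow> bool" where
  "weakly_layered F \<L> R \<longleftrightarrow>
    (\<forall>rl \<in> R. \<forall>s \<in> terms F. \<forall>t M p.
      is_max_top F \<L> s M \<and> p \<in> fun_poss M \<and> rstep_at p rl s t \<longrightarrow>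
      (\<exists>L \<in> \<L>. rstep_at p rl M L))"

end

theory Submission
  imports Defs
begin

text \<open>
  Induction on the rank. Let \<open>s\<close> have rank \<open>k + 2\<close> and cut off its tall aliens, those of rank
  \<open>k + 1\<close>. What remains, the base context of \<open>s\<close>, has rank at most \<open>k + 1\<close>, just like the tall
  aliens, so rewriting is confluent on either part. A step of \<open>s\<close> is a base step or a tall step;
  by left-linearity the two kinds commute as long as the decomposition is kept. The max-top may grow
  under rewriting and swallow part of a tall alien, but then only short aliens of it remain, so that
  all of it joins the base context. Therefore a tall step for the old decomposition is a tall step for the new one followed by base
  steps. Hence local peaks close in a decreasing way (base below tall) and \<open>T ; B\<^sup>*\<close>, where \<open>T\<close> are
  the parallel tall steps and \<open>B\<close> the base steps, has the diamond property.
\<close>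

section \<open>Filling holes\<close>

text \<open>The obstacle is that the layer produced by (W) is a top of the result but perhaps not
  its max-top, so a decomposition into max-top and aliens does not survive rewriting. Hence
  \<open>base\<close> accepts any top as witness, and maximality is imposed only where two steps
  must refer to the same aliens. Enlarging a base context affects the two kinds of steps
  differently: a base step remains one by left-linearity, whereas a tall step may end up inside the
  base context. This asymmetry puts base steps below tall steps. Short aliens stay in the base
  context for the sake of melting. If they were cut as well, a melted alien would be split between
  top and new holes, and its rewriting could interleave both kinds of steps, with no way to sort
  tall steps before base steps. Keeping them does no harm to the induction: with variables in place
  of the tall aliens, the remaining aliens have rank at most \<open>k\<close>, so the term has rank
  at most \<open>k + 1\<close>.\<close>

text \<open>
  \<open>D\<close> and \<open>E\<close> both arise from \<open>C\<close> by filling each occurrence of a hole independently, with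
  fillings related by \<open>Q\<close>. The order \<open>\<sqsubseteq>\<close>, aliens, decompositions of a term and parallel
  rewriting below a context are all instances of this relation.
\<close>

inductive fills ::
  "(('f, 'v) mctxt \<Rightarrow> ('f, 'v) mctxt \<Rightarrow> bool) \<Rightarrow>
    ('f, 'v) mctxt \<Rightarrow> ('f, 'v) mctxt \<Rightarrow> ('f, 'v) mctxt \<Rightarrow> bool" for Q where
  hole: "Q D E \<Longrightarrow> fills Q Hole D E"
| var: "fills Q (Var x) (Var x) (Var x)"
| app: "length ds = length cs \<Longrightarrow> length es = length cs \<Longrightarrow>
    (\<And>i. i < length cs \<Longrightarrow> fills Q (cs ! i) (ds ! i) (es ! i)) \<Longrightarrow>
    fills Q (Fun f cs) (Fun f ds) (Fun f es)"

lemma fills_Hole [simp]: "fills Q Hole D E \<longleftrightarrow> Q D E"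
  by (subst fills.simps) auto

lemma fills_Var [simp]: "fills Q (Var x) D E \<longleftrightarrow> D = Var x \<and> E = Var x"
  by (subst fills.simps) auto

lemma fills_Fun: "fills Q (Fun f cs) D E \<longleftrightarrow> (\<exists>ds es. D = Fun f ds \<and> E = Fun f es \<and>
    length ds = length cs \<and> length es = length cs \<and>
    (\<forall>i < length cs. fills Q (cs ! i) (ds ! i) (es ! i)))"
  by (subst fills.simps) auto

lemma fills_FunE:
  assumes "fills Q (Fun f cs) D E"
  obtains ds es where "D = Fun f ds" "E = Fun f es" "length ds = length cs"
    "length es = length cs" "\<And>i. i < length cs \<Longrightarrow> fills Q (cs ! i) (ds ! i) (es ! i)"
  using assms unfolding fills_Fun by blast

lemma fills_Fun_Fun [simp]: "fills Q (Fun f cs) (Fun g ds) (Fun h es) \<longleftrightarrow>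
    g = f \<and> h = f \<and> length ds = length cs \<and> length es = length cs \<and>
    (\<forall>i < length cs. fills Q (cs ! i) (ds ! i) (es ! i))"
  unfolding fills_Fun by auto

lemma fills_mono:
  "fills Q C D E \<Longrightarrow> (\<And>b u. Q b u \<Longrightarrow> Q' b u) \<Longrightarrow> fills Q' C D E"
  by (induction rule: fills.induct) (auto intro: fills.intros)

lemma fills_refl: "Q Hole Hole \<Longrightarrow> fills Q C C C"
  by (induction C) (auto)

section \<open>The order of contexts as hole filling\<close>

abbreviation pref :: "('f, 'v) mctxt \<Rightarrow> ('f, 'v) mctxt \<Rightarrow> bool" where
  "pref C D \<equiv> fills (=) C D D"

lemma pref_FunE:
  assumes "pref (Fun f cs) D"
  obtains ds where "D = Fun f ds" "length ds = length cs"
    "\<And>i. i < length cs \<Longrightarrow> pref (cs ! i) (ds ! i)"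
  using assms unfolding fills_Fun by auto

lemma pref_trans: "pref C D \<Longrightarrow> pref D E \<Longrightarrow> pref C E"
proof (induction C arbitrary: D E)
  case (Fun f cs)
  from Fun.prems obtain ds es where "D = Fun f ds" "E = Fun f es" "length ds = length cs"
    "length es = length cs" "\<And>i. i < length cs \<Longrightarrow> pref (cs ! i) (ds ! i)"
    "\<And>i. i < length cs \<Longrightarrow> pref (ds ! i) (es ! i)"
    by (metis pref_FunE)
  then show ?case using Fun.IH by (simp, metis nth_mem)
qed auto

lemma pref_antisym: "pref C D \<Longrightarrow> pref D C \<Longrightarrow> C = D"
proof (induction C arbitrary: D)
  case Hole
  then show ?case by (cases D) (auto simp: fills_Fun)
next
  case (Fun f cs)
  from Fun.prems(1) obtain ds where "D = Fun f ds" "length ds = length cs"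
    "\<And>i. i < length cs \<Longrightarrow> pref (cs ! i) (ds ! i)"
    by (metis pref_FunE)
  then show ?case using Fun.IH Fun.prems(2) by (auto intro!: nth_equalityI)
qed auto

lemma fills_pref_left: "fills Q C D E \<Longrightarrow> pref C D"
  by (induction rule: fills.induct) auto

lemma fills_pref_right: "fills Q C D E \<Longrightarrow> pref C E"
  by (induction rule: fills.induct) auto

text \<open>Holes weigh nothing, so the weight strictly increases along the order. It yields a
  heaviest top and a measure for erasing variables.\<close>

fun weight :: "('f, 'v) mctxt \<Rightarrow> nat" where
  "weight Hole = 0"
| "weight (Var x) = 1"
| "weight (Fun f ts) = Suc (sum_list (map weight ts))"

lemma sum_list_le_eq:
  fixes xs ys :: "nat list"
  assumes "length xs = length ys" "\<And>i. i < length xs \<Longrightarrow> xs ! i \<le> ys ! i"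
  shows "sum_list xs \<le> sum_list ys" "sum_list ys \<le> sum_list xs \<Longrightarrow> xs = ys"
proof -
  have "list_all2 (\<le>) xs ys" using assms by (simp add: list_all2_conv_all_nth)
  then have "sum_list xs \<le> sum_list ys \<and> (sum_list ys \<le> sum_list xs \<longrightarrow> xs = ys)"
    by (induction rule: list_all2_induct) auto
  then show "sum_list xs \<le> sum_list ys" "sum_list ys \<le> sum_list xs \<Longrightarrow> xs = ys" by auto
qed

lemma pref_weight: "pref C D \<Longrightarrow> weight C \<le> weight D \<and> (weight D \<le> weight C \<longrightarrow> C = D)"
proof (induction C arbitrary: D)
  case Hole
  then show ?case by (cases D) auto
next
  case (Fun f cs)
  from Fun.prems obtain ds where ds: "D = Fun f ds" "length ds = length cs"
    "\<And>i. i < length cs \<Longrightarrow> pref (cs ! i) (ds ! i)"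
    by (metis pref_FunE)
  have le: "weight (cs ! i) \<le> weight (ds ! i)"
    and eq: "weight (ds ! i) \<le> weight (cs ! i) \<Longrightarrow> cs ! i = ds ! i" if "i < length cs" for i
    using Fun.IH[OF nth_mem[OF that] ds(3)[OF that]] by auto
  have "C = D" if "map weight cs = map weight ds" "C = Fun f cs" for C
  proof -
    have "cs = ds"
      using ds(2) eq that(1) by (intro nth_equalityI) (auto simp: list_eq_iff_nth_eq)
    then show ?thesis using that ds by simp
  qed
  then show ?case
    using sum_list_le_eq[of "map weight cs" "map weight ds"] le ds by auto
qed auto

text \<open>Contexts below a common bound never clash at a symbol, so their join can be built
  argument by argument.\<close>

lemma pref_join:
  assumes "pref A C" "pref B C"
  shows "\<exists>E. pref A E \<and> pref B E \<and> pref E C \<and> (\<forall>E'. pref A E' \<longrightarrow> pref B E' \<longrightarrow> pref E E')"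
  using assms
proof (induction A arbitrary: B C)
  case Hole
  then show ?case by (auto intro!: exI[of _ B] fills_refl)
next
  case (Var x)
  then show ?case by (auto intro!: exI[of _ "Var x"])
next
  case (Fun f as)
  show ?case
  proof (cases B)
    case Hole
    then show ?thesis using Fun.prems by (auto intro!: exI[of _ "Fun f as"] fills_refl)
  next
    case (Var x)
    then show ?thesis using Fun.prems by auto
  next
    case (Fun g bs)
    obtain cs where cs: "C = Fun f cs" "length cs = length as" "g = f" "length bs = length as"
      "\<And>i. i < length as \<Longrightarrow> pref (as ! i) (cs ! i)" "\<And>i. i < length as \<Longrightarrow> pref (bs ! i) (cs ! i)"
      using Fun.prems Fun by (auto elim!: pref_FunE)
    have "\<exists>E. pref (as ! i) E \<and> pref (bs ! i) E \<and> pref E (cs ! i) \<and>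
        (\<forall>E'. pref (as ! i) E' \<longrightarrow> pref (bs ! i) E' \<longrightarrow> pref E E')" if "i < length as" for i
      using Fun.IH[OF nth_mem[OF that] cs(5)[OF that] cs(6)[OF that]] .
    then obtain e where e: "\<And>i. i < length as \<Longrightarrow> pref (as ! i) (e i) \<and> pref (bs ! i) (e i) \<and>
        pref (e i) (cs ! i) \<and> (\<forall>E'. pref (as ! i) E' \<longrightarrow> pref (bs ! i) E' \<longrightarrow> pref (e i) E')"
      by metis
    show ?thesis
      by (rule exI[of _ "Fun f (map e [0..<length as])"])
        (use e cs Fun in \<open>auto elim!: pref_FunE\<close>)
  qed
qed

section \<open>Agreement with the inductively defined order\<close>

lemma contexts_Fun: "Fun f ts \<in> contexts F \<longleftrightarrow> (f, length ts) \<in> F \<and> (\<forall>t \<in> set ts. t \<in> contexts F)"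
  by (subst contexts.simps) auto

lemma terms_Fun: "Fun f ts \<in> terms F \<longleftrightarrow> (f, length ts) \<in> F \<and> (\<forall>t \<in> set ts. t \<in> terms F)"
  by (subst terms.simps) auto

lemma Hole_notin_terms [simp]: "Hole \<notin> terms F"
  by (subst terms.simps) auto

lemma leaf_in_contexts [simp]: "Hole \<in> contexts F" "Var x \<in> contexts F" "Var x \<in> terms F"
  by (auto intro: contexts.intros terms.intros)

lemma terms_contexts: "t \<in> terms F \<Longrightarrow> t \<in> contexts F"
  by (induction t) (auto simp: terms_Fun contexts_Fun)

lemma pref_contexts: "pref C D \<Longrightarrow> D \<in> contexts F \<Longrightarrow> C \<in> contexts F"
proof (induction C arbitrary: D)
  case (Fun f cs)
  then show ?case
    by (auto elim!: pref_FunE simp: contexts_Fun) (metis Fun.IH in_set_conv_nth)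
qed auto

lemma poss_Fun_Cons [simp]: "i # p \<in> poss (Fun f ts) \<longleftrightarrow> i < length ts \<and> p \<in> poss (ts ! i)"
  by auto

lemma Nil_in_poss [simp]: "[] \<in> poss C"
  by (cases C) auto

declare poss.simps(3) [simp del]

lemma subt_at_contexts: "C \<in> contexts F \<Longrightarrow> p \<in> poss C \<Longrightarrow> subt_at C p \<in> contexts F"
  by (induction C p rule: subt_at.induct) (auto simp: contexts_Fun)

lemma subt_at_terms: "C \<in> terms F \<Longrightarrow> p \<in> poss C \<Longrightarrow> subt_at C p \<in> terms F"
  by (induction C p rule: subt_at.induct) (auto simp: terms_Fun)

lemma replace_at_contexts:
  "C \<in> contexts F \<Longrightarrow> D \<in> contexts F \<Longrightarrow> replace_at C p D \<in> contexts F"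
proof (induction C p D rule: replace_at.induct)
  case (2 f ts i p D)
  show ?case
  proof (cases "i < length ts")
    case True
    then show ?thesis
      using 2 by (auto simp: contexts_Fun dest!: set_update_subset_insert[THEN subsetD])
  next
    case False
    then show ?thesis using 2 by (simp add: list_update_beyond)
  qed
qed auto

lemma replace_at_terms:
  "C \<in> terms F \<Longrightarrow> D \<in> terms F \<Longrightarrow> p \<in> poss C \<Longrightarrow> replace_at C p D \<in> terms F"
  by (induction C p D rule: replace_at.induct)
    (auto simp: terms_Fun dest!: set_update_subset_insert[THEN subsetD])

lemma replace_at_pref:
  "pref C D \<Longrightarrow> pref (replace_at E p C) (replace_at E p D)"
proof (induction E p C rule: replace_at.induct)
  case (2 f ts i p C)
  then show ?case
    by (cases "i < length ts") (auto simp: nth_list_update intro!: fills_refl)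
qed (auto intro!: fills_refl)

lemma ctxt_le_imp: "ctxt_le F C D \<Longrightarrow> pref C D \<and> C \<in> contexts F \<and> D \<in> contexts F"
proof (induction rule: ctxt_le.induct)
  case (trans C D E)
  then show ?case by (auto intro: pref_trans)
next
  case (mono C D E p)
  then show ?case by (auto intro: replace_at_pref replace_at_contexts)
qed (auto intro: fills_refl)

text \<open>Rule \<open>mono\<close> changes a single position, so the arguments are exchanged one
  after the other: after \<open>n\<close> rounds the first \<open>n\<close> come from
  \<open>ds\<close>.\<close>

lemma ctxt_le_args:
  assumes "length cs = length ds" "Fun f ds \<in> contexts F"
    "\<And>i. i < length ds \<Longrightarrow> ctxt_le F (cs ! i) (ds ! i)"
  shows "ctxt_le F (Fun f cs) (Fun f ds)"
proof -
  have "ctxt_le F (Fun f cs) (Fun f (take n ds @ drop n cs))" if "n \<le> length ds" for n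
    using that
  proof (induction n)
    case 0
    have "cs ! i \<in> contexts F" if "i < length cs" for i
      using ctxt_le_imp[OF assms(3)] that assms(1) by auto
    then have "Fun f cs \<in> contexts F"
      using assms(1,2) by (auto simp: contexts_Fun in_set_conv_nth)
    then show ?case by (auto intro: ctxt_le.refl)
  next
    case (Suc n)
    let ?E = "Fun f (take n ds @ cs ! n # drop (Suc n) cs)"
    have E: "take n ds @ drop n cs = take n ds @ cs ! n # drop (Suc n) cs"
      using Suc.prems assms(1) by (simp add: Cons_nth_drop_Suc)
    have IH: "ctxt_le F (Fun f cs) ?E" using Suc E by simp
    have *: "ctxt_le F (cs ! n) (ds ! n)" using assms(3) Suc.prems by simp
    have "ctxt_le F (replace_at ?E [n] (cs ! n)) (replace_at ?E [n] (ds ! n))"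
    proof (rule ctxt_le.mono[OF *])
      show "?E \<in> contexts F" using ctxt_le_imp[OF IH] by blast
      have "(take n ds @ cs ! n # drop (Suc n) cs) ! n = cs ! n"
        using Suc.prems by (simp add: nth_append)
      then show "[n] \<in> poss ?E" using Suc.prems by simp
    qed
    moreover have "replace_at ?E [n] (cs ! n) = ?E"
      using Suc.prems by (simp add: list_update_append)
    moreover have "replace_at ?E [n] (ds ! n) = Fun f (take (Suc n) ds @ drop (Suc n) cs)"
      using Suc.prems by (simp add: list_update_append take_Suc_conv_app_nth)
    ultimately show ?case using IH by (metis ctxt_le.trans)
  qed
  from this[of "length ds"] show ?thesis using assms(1) by simp
qed

lemma pref_imp_ctxt_le: "pref C D \<Longrightarrow> D \<in> contexts F \<Longrightarrow> ctxt_le F C D"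
proof (induction C arbitrary: D)
  case Hole
  then show ?case by (auto intro: ctxt_le.hole)
next
  case (Var x)
  then show ?case by (auto intro: ctxt_le.refl)
next
  case (Fun f cs)
  from Fun.prems obtain ds where ds: "D = Fun f ds" "length ds = length cs"
    "\<And>i. i < length cs \<Longrightarrow> pref (cs ! i) (ds ! i)"
    by (metis pref_FunE)
  then show ?case using Fun.IH Fun.prems by (auto intro!: ctxt_le_args simp: contexts_Fun)
qed

text \<open>The rules \<open>trans\<close> and \<open>mono\<close> obstruct inversion; from here on
  the order can be inverted symbol by symbol.\<close>

lemma ctxt_le_iff: "ctxt_le F C D \<longleftrightarrow> pref C D \<and> D \<in> contexts F"
  using ctxt_le_imp pref_imp_ctxt_le by blast

section \<open>Substitutions and rewrite steps\<close>

lemma subst_subst: "subst \<sigma> (subst \<tau> t) = subst (\<lambda>x. subst \<sigma> (\<tau> x)) t"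
  by (induction t) auto

lemma subst_cong: "(\<And>x. x \<in> vars t \<Longrightarrow> \<sigma> x = \<tau> x) \<Longrightarrow> subst \<sigma> t = subst \<tau> t"
  by (induction t) auto

lemma subst_eq_imp: "subst \<sigma> t = subst \<tau> t \<Longrightarrow> x \<in> vars t \<Longrightarrow> \<sigma> x = \<tau> x"
  by (induction t) auto

lemma subst_ident: "(\<And>x. x \<in> vars t \<Longrightarrow> \<sigma> x = Var x) \<Longrightarrow> subst \<sigma> t = t"
  by (induction t) (auto intro: map_idI)

lemma subst_contexts: "C \<in> contexts F \<Longrightarrow> (\<And>x. \<sigma> x \<in> contexts F) \<Longrightarrow> subst \<sigma> C \<in> contexts F"
  by (induction C) (auto simp: contexts_Fun)

lemma subst_in_terms: "subst \<sigma> t \<in> terms F \<Longrightarrow> x \<in> vars t \<Longrightarrow> \<sigma> x \<in> terms F"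
  by (induction t) (auto simp: terms_Fun)

lemma subst_terms: "t \<in> terms F \<Longrightarrow> (\<And>x. x \<in> vars t \<Longrightarrow> \<sigma> x \<in> terms F) \<Longrightarrow> subst \<sigma> t \<in> terms F"
  by (induction t) (auto simp: terms_Fun)

lemma pref_subst: "pref C D \<Longrightarrow> pref (subst \<sigma> C) (subst \<sigma> D)"
proof (induction C arbitrary: D)
  case (Var x)
  then show ?case by (auto intro: fills_refl)
next
  case (Fun f cs)
  then show ?case by (auto elim!: pref_FunE)
qed auto

lemma subst_subt_at: "p \<in> poss C \<Longrightarrow> p \<in> poss (subst \<sigma> C) \<and> subt_at (subst \<sigma> C) p = subst \<sigma> (subt_at C p)"
  by (induction C p rule: subt_at.induct) auto

lemma subst_replace_at:
  "p \<in> poss C \<Longrightarrow> subst \<sigma> (replace_at C p D) = replace_at (subst \<sigma> C) p (subst \<sigma> D)"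
  by (induction C p D rule: replace_at.induct) (auto simp: map_update)

lemma fills_subst:
  "t \<in> terms F \<Longrightarrow> (\<And>x. x \<in> vars t \<Longrightarrow> fills Q (\<tau> x) (\<sigma> x) (\<theta> x)) \<Longrightarrow>
    fills Q (subst \<tau> t) (subst \<sigma> t) (subst \<theta> t)"
proof (induction t)
  case (Fun f ts)
  have "fills Q (subst \<tau> (ts ! i)) (subst \<sigma> (ts ! i)) (subst \<theta> (ts ! i))" if "i < length ts" for i
    using Fun nth_mem[OF that] by (fastforce simp: terms_Fun)
  then show ?case by simp
qed auto

lemma fills_subt_at:
  "fills Q C D E \<Longrightarrow> p \<in> poss C \<Longrightarrow>
    p \<in> poss D \<and> p \<in> poss E \<and> fills Q (subt_at C p) (subt_at D p) (subt_at E p)"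
proof (induction C p arbitrary: D E rule: subt_at.induct)
  case (2 f ts i p)
  from 2(2) show ?case by (rule fills_FunE) (use 2 in auto)
qed auto

lemma fills_replace_at:
  "fills Q C D E \<Longrightarrow> p \<in> poss C \<Longrightarrow> fills Q a b c \<Longrightarrow>
    fills Q (replace_at C p a) (replace_at D p b) (replace_at E p c)"
proof (induction C p a arbitrary: D E rule: replace_at.induct)
  case (2 f ts i p a)
  from 2(2) show ?case by (rule fills_FunE) (use 2 in \<open>auto simp: nth_list_update\<close>)
qed auto

lemma vars_poss: "x \<in> vars t \<Longrightarrow> \<exists>p \<in> poss t. subt_at t p = Var x"
proof (induction t)
  case (Fun f ts)
  then obtain i where i: "i < length ts" "x \<in> vars (ts ! i)"
    by (auto simp: in_set_conv_nth)
  then obtain p where "p \<in> poss (ts ! i)" "subt_at (ts ! i) p = Var x"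
    using Fun.IH nth_mem by blast
  then show ?case using i by (intro bexI[of _ "i # p"]) auto
qed auto

lemma linear_term_args:
  assumes "linear_term (Fun f ts)"
  shows "i < length ts \<Longrightarrow> linear_term (ts ! i)"
    and "i < length ts \<Longrightarrow> j < length ts \<Longrightarrow> x \<in> vars (ts ! i) \<Longrightarrow> x \<in> vars (ts ! j) \<Longrightarrow> i = j"
proof -
  have *: "i = j \<and> p = q" if "i < length ts" "j < length ts" "p \<in> poss (ts ! i)" "q \<in> poss (ts ! j)"
    "subt_at (ts ! i) p = Var x" "subt_at (ts ! j) q = Var x" for i j p q x
  proof -
    have "i # p = j # q"
      using assms that unfolding linear_term_def
      by (metis poss_Fun_Cons subt_at.simps(2))
    then show ?thesis by simp
  qed
  show "i < length ts \<Longrightarrow> linear_term (ts ! i)"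
    unfolding linear_term_def using * by blast
  show "i < length ts \<Longrightarrow> j < length ts \<Longrightarrow> x \<in> vars (ts ! i) \<Longrightarrow> x \<in> vars (ts ! j) \<Longrightarrow> i = j"
    using * vars_poss by metis
qed

text \<open>The only place where linearity matters: the holes of an instance of a linear \<open>l\<close> may be filled
  independently without destroying the match.\<close>

lemma fills_match:
  assumes "l \<in> terms F" "linear_term l" "fills Q (subst \<tau> l) D E"
  shows "\<exists>\<sigma> \<theta>. D = subst \<sigma> l \<and> E = subst \<theta> l \<and> (\<forall>x \<in> vars l. fills Q (\<tau> x) (\<sigma> x) (\<theta> x))"
  using assms
proof (induction l arbitrary: D E rule: mctxt.induct)
  case (Var x)
  then show ?case by - (rule exI[where x = "\<lambda>_. D"], rule exI[where x = "\<lambda>_. E"], simp)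
next
  case (Fun f ls)
  from Fun.prems(3) obtain ds es where de: "D = Fun f ds" "E = Fun f es" "length ds = length ls"
    "length es = length ls" "\<And>i. i < length ls \<Longrightarrow> fills Q (subst \<tau> (ls ! i)) (ds ! i) (es ! i)"
    by (auto elim!: fills_FunE)
  have "\<exists>\<sigma> \<theta>. ds ! i = subst \<sigma> (ls ! i) \<and> es ! i = subst \<theta> (ls ! i) \<and>
      (\<forall>x \<in> vars (ls ! i). fills Q (\<tau> x) (\<sigma> x) (\<theta> x))" if "i < length ls" for i
    using Fun.IH[OF nth_mem[OF that] _ _ de(5)[OF that]] Fun.prems that
    by (auto simp: terms_Fun dest: linear_term_args(1))
  then obtain \<sigma> \<theta> where st: "\<And>i. i < length ls \<Longrightarrow> ds ! i = subst (\<sigma> i) (ls ! i) \<and>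
      es ! i = subst (\<theta> i) (ls ! i) \<and> (\<forall>x \<in> vars (ls ! i). fills Q (\<tau> x) (\<sigma> i x) (\<theta> i x))"
    by metis
  \<comment> \<open>By linearity a variable occurs in one argument only; \<open>k\<close> selects
    it, which merges the substitutions of the arguments into one.\<close>
  define k where "k x = (SOME i. i < length ls \<and> x \<in> vars (ls ! i))" for x
  have k: "k x = i" if "i < length ls" "x \<in> vars (ls ! i)" for x i
  proof -
    have "k x < length ls \<and> x \<in> vars (ls ! k x)"
      unfolding k_def using that by (rule_tac someI[of _ i]) auto
    then show ?thesis using linear_term_args(2)[OF Fun.prems(2)] that by blast
  qed
  let ?s = "\<lambda>x. \<sigma> (k x) x" and ?t = "\<lambda>x. \<theta> (k x) x"
  have "ds ! i = subst ?s (ls ! i)" "es ! i = subst ?t (ls ! i)" if "i < length ls" for i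
    using st[OF that] k[OF that] by (auto intro: subst_cong)
  then have "D = subst ?s (Fun f ls)" "E = subst ?t (Fun f ls)"
    using de by (auto intro!: nth_equalityI)
  moreover have "fills Q (\<tau> x) (?s x) (?t x)" if "x \<in> vars (Fun f ls)" for x
    using that st k by (auto simp: in_set_conv_nth)
  ultimately show ?case by blast
qed auto

text \<open>By \<open>fills_match\<close> a redex of \<open>C\<close> survives every filling of the
  holes. All commutation results below rest on this simulation.\<close>

lemma rstep_at_fills:
  assumes "fst rl \<in> terms F" "snd rl \<in> terms F" "vars (snd rl) \<subseteq> vars (fst rl)" "linear_term (fst rl)"
    and "fills Q C D E" "rstep_at p rl C C'"
  shows "\<exists>D' E'. rstep_at p rl D D' \<and> rstep_at p rl E E' \<and> fills Q C' D' E'"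
proof -
  obtain \<tau> where t: "p \<in> poss C" "subt_at C p = subst \<tau> (fst rl)"
    "C' = replace_at C p (subst \<tau> (snd rl))"
    using assms(6) unfolding rstep_at_def by blast
  note f = fills_subt_at[OF assms(5) t(1)]
  obtain \<sigma> \<theta> where s: "subt_at D p = subst \<sigma> (fst rl)" "subt_at E p = subst \<theta> (fst rl)"
    "\<forall>x \<in> vars (fst rl). fills Q (\<tau> x) (\<sigma> x) (\<theta> x)"
    using fills_match[OF assms(1,4)] f t(2) by metis
  have "fills Q (subst \<tau> (snd rl)) (subst \<sigma> (snd rl)) (subst \<theta> (snd rl))"
    using assms(2,3) s(3) by (intro fills_subst) auto
  from fills_replace_at[OF assms(5) t(1) this] show ?thesis
    unfolding t(3) using f s unfolding rstep_at_def by blast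
qed

text \<open>The variables of the right-hand side occur on the left, so the match fixes the
  contractum. This identifies simulated steps with given ones.\<close>

lemma rstep_at_det:
  assumes "vars (snd rl) \<subseteq> vars (fst rl)" "rstep_at p rl s t" "rstep_at p rl s u"
  shows "t = u"
proof -
  obtain \<sigma> \<theta> where "subt_at s p = subst \<sigma> (fst rl)" "t = replace_at s p (subst \<sigma> (snd rl))"
    "subt_at s p = subst \<theta> (fst rl)" "u = replace_at s p (subst \<theta> (snd rl))"
    using assms(2,3) unfolding rstep_at_def by blast
  moreover from this have "subst \<sigma> (snd rl) = subst \<theta> (snd rl)"
    using assms(1) by (intro subst_cong) (metis subsetD subst_eq_imp)
  ultimately show ?thesis by simp
qed

lemma rstep_at_subst:
  assumes "rstep_at p rl s t"
  shows "rstep_at p rl (subst \<sigma> s) (subst \<sigma> t)"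
proof -
  obtain \<tau> where t: "p \<in> poss s" "subt_at s p = subst \<tau> (fst rl)"
    "t = replace_at s p (subst \<tau> (snd rl))"
    using assms unfolding rstep_at_def by blast
  then show ?thesis
    unfolding rstep_at_def using subst_subt_at[OF t(1)]
    by (auto simp: subst_replace_at subst_subst intro!: exI[of _ "\<lambda>x. subst \<sigma> (\<tau> x)"])
qed

lemma rstep_at_terms:
  assumes "snd rl \<in> terms F" "vars (snd rl) \<subseteq> vars (fst rl)" "rstep_at p rl s t" "s \<in> terms F"
  shows "t \<in> terms F"
proof -
  obtain \<tau> where t: "p \<in> poss s" "subt_at s p = subst \<tau> (fst rl)"
    "t = replace_at s p (subst \<tau> (snd rl))"
    using assms(3) unfolding rstep_at_def by blast
  have "\<tau> x \<in> terms F" if "x \<in> vars (snd rl)" for x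
    using subt_at_terms[OF assms(4) t(1)] assms(2) that t(2) by (metis subsetD subst_in_terms)
  then show ?thesis
    using t assms(1,4) by (auto intro!: replace_at_terms subst_terms)
qed

lemma rstep_at_Cons:
  "rstep_at (i # p) rl (Fun f ts) t \<longleftrightarrow>
    i < length ts \<and> (\<exists>t'. rstep_at p rl (ts ! i) t' \<and> t = Fun f (ts[i := t']))"
  unfolding rstep_at_def by auto

lemma rstep_at_no_Fun:
  assumes "fst rl \<in> terms F" "\<nexists>x. fst rl = Var x" "rstep_at p rl C D"
  shows "\<exists>f ts. subt_at C p = Fun f ts"
  using assms unfolding rstep_at_def by (cases "fst rl") auto

lemma replace_at_subt_at [simp]: "replace_at C p (subt_at C p) = C"
  by (induction C p rule: subt_at.induct) auto

lemma subt_at_replace_at: "p \<in> poss C \<Longrightarrow> subt_at (replace_at C p D) p = D"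
  by (induction C p D rule: replace_at.induct) auto

lemma poss_replace_at: "p \<in> poss C \<Longrightarrow> p \<in> poss (replace_at C p D)"
  by (induction C p D rule: replace_at.induct) auto

lemma subt_at_append:
  "p \<in> poss C \<Longrightarrow> q \<in> poss (subt_at C p) \<Longrightarrow>
    p @ q \<in> poss C \<and> subt_at C (p @ q) = subt_at (subt_at C p) q"
  by (induction C p rule: subt_at.induct) auto

lemma fun_poss_pref: "pref C D \<Longrightarrow> fun_poss C \<subseteq> fun_poss D"
proof
  fix p assume C: "pref C D" "p \<in> fun_poss C"
  then obtain f cs where p: "p \<in> poss C" "subt_at C p = Fun f cs" unfolding fun_poss_def by blast
  from fills_subt_at[OF C(1) p(1)] have "p \<in> poss D" "pref (Fun f cs) (subt_at D p)"
    using p(2) by auto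
  then show "p \<in> fun_poss D" unfolding fun_poss_def by (auto elim: pref_FunE)
qed

abbreviation aliens :: "(('f, 'v) mctxt \<Rightarrow> bool) \<Rightarrow> ('f, 'v) mctxt \<Rightarrow> ('f, 'v) mctxt \<Rightarrow> bool" where
  "aliens P L s \<equiv> fills (\<lambda>b u. b = u \<and> P u) L s s"

lemma fills_term: "t \<in> terms F \<Longrightarrow> fills Q t D E \<longleftrightarrow> D = t \<and> E = t"
proof (induction t arbitrary: D E rule: mctxt.induct)
  case (Fun f ts)
  then have "fills Q (ts ! i) D E \<longleftrightarrow> D = ts ! i \<and> E = ts ! i" if "i < length ts" for i D E
    using nth_mem[OF that] by (auto simp: terms_Fun)
  then show ?case by (auto simp: fills_Fun intro: nth_equalityI)
qed auto

lemma fills_flip: "fills Q C D E \<Longrightarrow> fills (\<lambda>e d. Q d e) C E D"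
  by (induction rule: fills.induct) auto

lemma fills_choice:
  assumes "\<And>d e. P d e \<Longrightarrow> \<exists>w. Q d w"
  shows "fills P C D E \<Longrightarrow> \<exists>W. fills Q C D W"
proof (induction rule: fills.induct)
  case (hole D E)
  then show ?case using assms by auto
next
  case (app ds cs es f)
  then have "\<forall>i. \<exists>W. i < length cs \<longrightarrow> fills Q (cs ! i) (ds ! i) W" by blast
  from choice[OF this] obtain w where "\<And>i. i < length cs \<Longrightarrow> fills Q (cs ! i) (ds ! i) (w i)"
    by blast
  then show ?case using app.hyps by (intro exI[of _ "Fun f (map w [0..<length cs])"]) simp
qed auto

lemma pref_finite_aliens: "pref C s \<Longrightarrow> \<exists>S. finite S \<and> aliens (\<lambda>u. u \<in> S) C s"
proof (induction C arbitrary: s)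
  case Hole
  then show ?case by (auto intro: exI[of _ "{s}"])
next
  case (Fun f cs)
  from Fun.prems obtain ss where ss: "s = Fun f ss" "length ss = length cs"
    "\<And>i. i < length cs \<Longrightarrow> pref (cs ! i) (ss ! i)" by (rule pref_FunE) auto
  have "\<exists>S. i < length cs \<longrightarrow> finite S \<and> aliens (\<lambda>u. u \<in> S) (cs ! i) (ss ! i)" for i
    using Fun.IH[OF nth_mem ss(3)] by blast
  then have "\<exists>S. \<forall>i. i < length cs \<longrightarrow> finite (S i) \<and> aliens (\<lambda>u. u \<in> S i) (cs ! i) (ss ! i)"
    by (rule choice[OF allI])
  then obtain S where S: "\<And>i. i < length cs \<Longrightarrow> finite (S i)"
    "\<And>i. i < length cs \<Longrightarrow> aliens (\<lambda>u. u \<in> S i) (cs ! i) (ss ! i)" by blast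
  have "aliens (\<lambda>u. u \<in> (\<Union>i < length cs. S i)) (cs ! i) (ss ! i)" if "i < length cs" for i
    by (rule fills_mono[OF S(2)[OF that]]) (use that in auto)
  then show ?case using S(1) ss by (intro exI[of _ "\<Union>i < length cs. S i"]) simp
qed auto

lemma finite_inj_into_infinite:
  assumes "finite S" "infinite A"
  shows "\<exists>h. inj_on h S \<and> h ` S \<subseteq> A"
proof -
  obtain g :: "'a \<Rightarrow> nat" where "inj_on g S" using finite_imp_inj_to_nat_seg[OF assms(1)] by blast
  moreover obtain e :: "nat \<Rightarrow> 'b" where "inj e" "range e \<subseteq> A"
    using infinite_countable_subset[OF assms(2)] by blast
  ultimately show ?thesis
    by (intro exI[of _ "e \<circ> g"]) (auto simp: inj_on_def)
qed

text \<open>Pushing one tall step along a sequence of base steps (\<open>TBs\<close>) leaves only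
  base steps to be joined, and confluence of \<open>Bs\<close> joins them. For two tall steps,
  \<open>TT\<close> gives a peak of this kind on either side, whence the diamond property of
  \<open>T OO Bs\<^sup>*\<^sup>*\<close>.\<close>

lemma confluentp_tall_base:
  assumes BB: "\<And>x y z. Bs x y \<Longrightarrow> Bs x z \<Longrightarrow> \<exists>w. Bs y w \<and> Bs z w"
    and TT: "\<And>x y z. T x y \<Longrightarrow> T x z \<Longrightarrow> \<exists>y' z' w. T y y' \<and> Bs y' w \<and> T z z' \<and> Bs z' w"
    and TB: "\<And>x y z. T x y \<Longrightarrow> Bs x z \<Longrightarrow> \<exists>w z'. Bs y w \<and> T z z' \<and> Bs z' w"
  shows "confluentp (T OO Bs\<^sup>*\<^sup>*)"
proof -
  have "confluentp Bs"
    by (rule strong_confluentp_imp_confluentp, rule strong_confluentpI) (use BB in blast)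
  note BBs = confluentpD[OF this]
  have ext: "(T OO Bs\<^sup>*\<^sup>*) x z" if "(T OO Bs\<^sup>*\<^sup>*) x y" "Bs\<^sup>*\<^sup>* y z" for x y z
    using that by (auto intro: rtranclp_trans)
  have TBs: "\<exists>w. Bs\<^sup>*\<^sup>* y w \<and> (T OO Bs\<^sup>*\<^sup>*) z w" if "Bs\<^sup>*\<^sup>* x z" "T x y" for x y z
    using that
  proof (induction arbitrary: y rule: converse_rtranclp_induct)
    case base
    then show ?case by blast
  next
    case (step x a)
    obtain w1 a' where 1: "Bs y w1" "T a a'" "Bs a' w1" using TB step.hyps(1) step.prems by blast
    obtain w2 where 2: "Bs\<^sup>*\<^sup>* a' w2" "(T OO Bs\<^sup>*\<^sup>*) z w2" using step.IH[OF 1(2)] by blast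
    obtain w where "Bs\<^sup>*\<^sup>* w1 w" "Bs\<^sup>*\<^sup>* w2 w" using BBs[of a' w1 w2] 1(3) 2(1) by blast
    moreover from this 1(1) have "Bs\<^sup>*\<^sup>* y w" by simp
    ultimately show ?case using ext[OF 2(2)] by blast
  qed
  have "\<exists>w. (T OO Bs\<^sup>*\<^sup>*) y w \<and> (T OO Bs\<^sup>*\<^sup>*) z w"
    if "(T OO Bs\<^sup>*\<^sup>*) x y" "(T OO Bs\<^sup>*\<^sup>*) x z" for x y z
  proof -
    obtain a where a: "T x a" "Bs\<^sup>*\<^sup>* a y" using \<open>(T OO Bs\<^sup>*\<^sup>*) x y\<close> by blast
    obtain b where b: "T x b" "Bs\<^sup>*\<^sup>* b z" using \<open>(T OO Bs\<^sup>*\<^sup>*) x z\<close> by blast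
    obtain a' b' v where v: "T a a'" "Bs a' v" "T b b'" "Bs b' v" using TT[OF a(1) b(1)] by blast
    obtain w1 where w1: "Bs\<^sup>*\<^sup>* a' w1" "(T OO Bs\<^sup>*\<^sup>*) y w1" using TBs[OF a(2) v(1)] by blast
    obtain w2 where w2: "Bs\<^sup>*\<^sup>* b' w2" "(T OO Bs\<^sup>*\<^sup>*) z w2" using TBs[OF b(2) v(3)] by blast
    obtain u1 where u1: "Bs\<^sup>*\<^sup>* w1 u1" "Bs\<^sup>*\<^sup>* v u1" using BBs[of a' w1 v] w1 v by blast
    obtain u2 where u2: "Bs\<^sup>*\<^sup>* w2 u2" "Bs\<^sup>*\<^sup>* v u2" using BBs[of b' w2 v] w2 v by blast
    obtain w where "Bs\<^sup>*\<^sup>* u1 w" "Bs\<^sup>*\<^sup>* u2 w" using BBs u1 u2 by blast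
    then show ?thesis
      using ext[OF w1(2) rtranclp_trans[OF u1(1)]] ext[OF w2(2) rtranclp_trans[OF u2(1)]] by blast
  qed
  then show ?thesis
    by (intro strong_confluentp_imp_confluentp strong_confluentpI) blast
qed

section \<open>Max-tops\<close>

locale layered =
  fixes F :: "('f \<times> nat) set"
    and \<L> :: "('f, 'v) mctxt set"
    and R :: "('f, 'v) rule set"
  assumes infinite_vars: "infinite (UNIV :: 'v set)"
    and layer_system: "layer_system F \<L>"
    and trs: "trs F R"
    and weakly_layered: "weakly_layered F \<L> R"
    and left_linear: "left_linear R"
begin

lemma rules:
  assumes "rl \<in> R"
  shows "fst rl \<in> terms F" "snd rl \<in> terms F" "vars (snd rl) \<subseteq> vars (fst rl)"
    "linear_term (fst rl)" "\<nexists>x. fst rl = Var x"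
  using assms trs left_linear unfolding trs_def left_linear_def by fastforce+

lemma no_step_leaf:
  assumes "rl \<in> R" "rstep_at p rl C D"
  shows "C \<noteq> Hole" "C \<noteq> Var x"
  using rstep_at_no_Fun[OF rules(1,5)[OF assms(1)] assms(2)] assms(2)
  unfolding rstep_at_def by auto

lemma layer_contexts: "L \<in> \<L> \<Longrightarrow> L \<in> contexts F"
  using layer_system unfolding layer_system_def by blast

lemma layer_nontrivial_top: "t \<in> terms F \<Longrightarrow> \<exists>L \<in> \<L>. pref L t \<and> L \<noteq> Hole"
  using layer_system unfolding layer_system_def is_top_def ctxt_le_iff by blast

lemma layer_var_hole:
  "C \<in> contexts F \<Longrightarrow> p \<in> poss C \<Longrightarrow> replace_at C p (Var x) \<in> \<L> \<longleftrightarrow> replace_at C p Hole \<in> \<L>"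
  using layer_system unfolding layer_system_def by blast

lemma layer_join:
  "L \<in> \<L> \<Longrightarrow> N \<in> \<L> \<Longrightarrow> p \<in> fun_poss L \<Longrightarrow> is_join F (subt_at L p) N E \<Longrightarrow> replace_at L p E \<in> \<L>"
  using layer_system unfolding layer_system_def by blast

text \<open>By (L1) a variable has a nontrivial top, which can only be the variable itself; (L2) at
  the root turns it into the hole.\<close>

lemma Hole_layer: "Hole \<in> \<L>"
proof -
  fix x :: 'v
  obtain L where "L \<in> \<L>" "pref L (Var x)" "L \<noteq> Hole"
    using layer_nontrivial_top[of "Var x"] by auto
  then have "Var x \<in> \<L>" by (cases L) (auto elim: pref_FunE)
  then show ?thesis using layer_var_hole[of Hole "[]" x] by simp
qed

text \<open>(L2) erases one variable occurrence at a time, and each erasure lowers the weight. So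
  layers may be compared up to exchanging variables and holes.\<close>

lemma layer_skeleton: "C \<in> contexts F \<Longrightarrow> subst (\<lambda>_. Hole) C \<in> \<L> \<longleftrightarrow> C \<in> \<L>"
proof (induction "weight C" arbitrary: C rule: less_induct)
  case less
  show ?case
  proof (cases "vars C = {}")
    case True
    then have "subst (\<lambda>_. Hole) C = C" by (intro subst_ident) auto
    then show ?thesis by (simp only:)
  next
    case False
    then obtain x where "x \<in> vars C" by blast
    from vars_poss[OF this] obtain p where p: "p \<in> poss C" "subt_at C p = Var x"
      by blast
    let ?D = "replace_at C p Hole"
    have C: "replace_at C p (Var x) = C" using replace_at_subt_at[of C p] unfolding p(2) .
    have "pref ?D C" using replace_at_pref[of Hole "Var x" C p] unfolding C by simp
    moreover have "?D \<noteq> C"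
    proof
      assume "?D = C"
      from subt_at_replace_at[OF p(1), of Hole, unfolded this] show False using p(2) by simp
    qed
    ultimately have "weight ?D < weight C" using pref_weight[of ?D C] by linarith
    moreover have "?D \<in> contexts F" by (intro replace_at_contexts less.prems) simp
    ultimately have "subst (\<lambda>_. Hole) ?D \<in> \<L> \<longleftrightarrow> ?D \<in> \<L>" by (rule less.hyps)
    moreover have "subst (\<lambda>_. Hole) ?D = subst (\<lambda>_. Hole) C"
    proof -
      have "subst (\<lambda>_. Hole) ?D = subst (\<lambda>_. Hole) (replace_at C p (Var x))"
        by (simp add: subst_replace_at[OF p(1)])
      then show ?thesis unfolding C .
    qed
    ultimately show ?thesis using layer_var_hole[OF less.prems p(1), of x] unfolding C by (simp only:)
  qed
qed

text \<open>The greatest top, not just a maximal one; (L3) at the root makes it exist. Holes in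
  \<open>C\<close> are allowed because base contexts need max-tops too.\<close>

definition mtop :: "('f, 'v) mctxt \<Rightarrow> ('f, 'v) mctxt \<Rightarrow> bool" where
  "mtop C M \<longleftrightarrow> C \<in> contexts F \<and> M \<in> \<L> \<and> pref M C \<and> (\<forall>L \<in> \<L>. pref L C \<longrightarrow> pref L M)"

lemma is_joinI:
  assumes "pref A C" "pref B C" "C \<in> contexts F"
  shows "\<exists>E. is_join F A B E \<and> pref A E \<and> pref B E \<and> pref E C"
proof -
  obtain E where "pref A E \<and> pref B E \<and> pref E C \<and> (\<forall>E'. pref A E' \<longrightarrow> pref B E' \<longrightarrow> pref E E')"
    using pref_join[OF assms(1,2)] by blast
  then show ?thesis
    using pref_contexts[of E C F] assms(3) unfolding is_join_def ctxt_le_iff by blast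
qed

lemma mtop_exists:
  assumes "C \<in> contexts F"
  shows "\<exists>M. mtop C M"
proof -
  have "\<exists>M. (M \<in> \<L> \<and> pref M C) \<and> (\<forall>L. L \<in> \<L> \<and> pref L C \<longrightarrow> weight L \<le> weight M)"
    by (rule ex_has_greatest_nat[of "\<lambda>M. M \<in> \<L> \<and> pref M C" Hole weight "Suc (weight C)"])
      (use Hole_layer pref_weight in \<open>auto simp: less_Suc_eq_le\<close>)
  then obtain M where M: "M \<in> \<L>" "pref M C"
    "\<And>L. L \<in> \<L> \<Longrightarrow> pref L C \<Longrightarrow> weight L \<le> weight M"
    by blast
  have "pref L M" if L: "L \<in> \<L>" "pref L C" for L
  \<comment> \<open>(L3) joins at function positions only, so it applies to the heaviest top
    \<open>M\<close> just when its root is a function symbol.\<close>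
  proof (cases M)
    case Hole
    then show ?thesis using M(3)[OF L] pref_weight[of Hole L] by (auto intro: fills_refl)
  next
    case (Var x)
    then show ?thesis using M(2) L(2) by simp
  next
    case (Fun f ms)
    obtain E where E: "is_join F M L E" "pref M E" "pref L E" "pref E C"
      using is_joinI[OF M(2) L(2) assms] by blast
    have "E \<in> \<L>"
      using layer_join[OF M(1) L(1), of "[]" E] E(1) Fun unfolding fun_poss_def by simp
    then have "M = E" using M(3) E pref_weight by blast
    then show ?thesis using E by simp
  qed
  then show ?thesis using M assms unfolding mtop_def by blast
qed

lemma mtop_is_max_top: "mtop C M \<Longrightarrow> is_max_top F \<L> C M"
  unfolding mtop_def is_max_top_def is_top_def ctxt_le_iff using pref_antisym by blast

lemma finite_vars: "finite (vars t)"
  by (induction t) auto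

fun plug :: "'v \<Rightarrow> ('f, 'v) mctxt \<Rightarrow> ('f, 'v) mctxt" where
  "plug x Hole = Var x"
| "plug x (Var y) = Var y"
| "plug x (Fun f ts) = Fun f (map (plug x) ts)"

lemma plug_terms: "C \<in> contexts F \<Longrightarrow> plug x C \<in> terms F"
  by (induction C) (auto simp: contexts_Fun terms_Fun)

lemma unplug: "x \<notin> vars C \<Longrightarrow> subst (Var(x := Hole)) (plug x C) = C"
  by (induction C) (auto intro: map_idI)

lemma pref_plug: "pref C (plug x C)"
  by (induction C) auto

text \<open>Condition (W) lifted from terms to contexts: plug the holes of \<open>C\<close> with a fresh variable.\<close>

lemma mtop_step:
  assumes "mtop C M" "rl \<in> R" "rstep_at p rl C D" "p \<in> fun_poss M"
  shows "\<exists>L \<in> \<L>. rstep_at p rl M L"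
proof -
  have C: "C \<in> contexts F" "pref M C" "M \<in> \<L>" using assms(1) unfolding mtop_def by auto
  obtain x where x: "x \<notin> vars C \<union> vars M"
    using ex_new_if_finite[OF infinite_vars, of "vars C \<union> vars M"] finite_vars by blast
  let ?s = "plug x C" and ?u = "subst (Var(x := Hole))"
  obtain N where N: "mtop ?s N"
    using mtop_exists terms_contexts[OF plug_terms[OF C(1)]] by blast
  have u: "?u L \<in> \<L>" if "L \<in> \<L>" for L
  proof -
    have "subst (\<lambda>_. Hole) (?u L) = subst (\<lambda>_. Hole) L"
      unfolding subst_subst by (rule subst_cong) auto
    moreover have "?u L \<in> contexts F" using that by (auto intro: subst_contexts[OF layer_contexts])
    ultimately show ?thesis
      using that layer_skeleton[of "?u L"] layer_skeleton[of L] layer_contexts[of L] by simp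
  qed
  have NN: "N \<in> \<L>" "pref N ?s" using N unfolding mtop_def by auto
  have "?u ?s = C" using x by (intro unplug) simp
  then have "pref (?u N) C" using pref_subst[OF NN(2), of "Var(x := Hole)"] by (simp only:)
  then have 1: "pref (?u N) M" using u[OF NN(1)] assms(1) unfolding mtop_def by blast
  have "pref M ?s" by (rule pref_trans[OF C(2) pref_plug])
  then have "pref M N" using N C(3) unfolding mtop_def by blast
  then have 2: "pref (?u M) (?u N)" by (rule pref_subst)
  have "?u M = M" using x by (intro subst_ident) auto
  with 2 have "pref M (?u N)" by (simp only:)
  \<comment> \<open>\<open>N\<close> may carry the fresh variable where \<open>M\<close> has a hole.
    Erasing it yields exactly \<open>M\<close>, so the step of \<open>N\<close> granted by (W)
    carries over.\<close>
  then have M: "M = ?u N" by (rule pref_antisym[OF _ 1])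
  have "\<exists>t. rstep_at p rl ?s t"
    using rstep_at_fills[OF rules(1-4)[OF assms(2)] pref_plug assms(3)] by blast
  moreover have "p \<in> fun_poss N"
    using fun_poss_pref[OF \<open>pref M N\<close>] assms(4) by blast
  ultimately obtain L where L: "L \<in> \<L>" "rstep_at p rl N L"
    using weakly_layered[unfolded weakly_layered_def, rule_format, OF assms(2) plug_terms[OF C(1)]]
      mtop_is_max_top[OF N] by blast
  show ?thesis using u[OF L(1)] rstep_at_subst[OF L(2)] M by blast
qed

text \<open>The trace of a max-top at a subterm \<open>u\<close>. It need not lie in \<open>\<L>\<close>, but by (L3) it contains all
  tops of \<open>u\<close> unless it is a hole.\<close>

definition dominates :: "('f, 'v) mctxt \<Rightarrow> ('f, 'v) mctxt \<Rightarrow> bool" where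
  "dominates N u \<longleftrightarrow> (\<exists>C M q. mtop C M \<and> q \<in> poss M \<and> N = subt_at M q \<and> u = subt_at C q)"

lemma dominates_pref: "dominates N u \<Longrightarrow> pref N u"
  unfolding dominates_def mtop_def using fills_subt_at by blast

lemma mtop_dominates: "mtop C M \<Longrightarrow> dominates M C"
  unfolding dominates_def by (intro exI[of _ C] exI[of _ M] exI[of _ "[]"]) simp

lemma dominates_args:
  assumes "dominates (Fun f ns) (Fun f us)" "i < length ns"
  shows "dominates (ns ! i) (us ! i)"
proof -
  obtain C M q where C: "mtop C M" "q \<in> poss M" "Fun f ns = subt_at M q" "Fun f us = subt_at C q"
    using assms(1) unfolding dominates_def by blast
  have "length us = length ns" using dominates_pref[OF assms(1)] by simp
  moreover have "q \<in> poss C" using C(1,2) fills_subt_at unfolding mtop_def by blast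
  ultimately have "q @ [i] \<in> poss M" "subt_at M (q @ [i]) = ns ! i" "subt_at C (q @ [i]) = us ! i"
    using subt_at_append[of q M "[i]"] subt_at_append[of q C "[i]"] C(2) assms(2)
    unfolding C(3,4)[symmetric] by simp_all
  then show ?thesis
    unfolding dominates_def by (intro exI[of _ C] exI[of _ M] exI[of _ "q @ [i]"]) (simp add: C(1))
qed

lemma dominates_top:
  assumes "dominates (Fun f ns) u" "L \<in> \<L>" "pref L u"
  shows "pref L (Fun f ns)"
proof -
  obtain C M q where C: "mtop C M" "q \<in> poss M" "Fun f ns = subt_at M q" "u = subt_at C q"
    using assms(1) unfolding dominates_def by blast
  have M: "M \<in> \<L>" "pref M C" "C \<in> contexts F" using C(1) unfolding mtop_def by auto
  note q = fills_subt_at[OF M(2) C(2)]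
  have "u \<in> contexts F" using subt_at_contexts M(3) q C(4) by blast
  from is_joinI[OF dominates_pref[OF assms(1)] assms(3) this]
  obtain E where E: "is_join F (Fun f ns) L E" "pref L E" "pref E u" by blast
  \<comment> \<open>Joining \<open>L\<close> into \<open>M\<close> at \<open>q\<close> gives another
    top of \<open>C\<close>; as \<open>M\<close> is the greatest one, \<open>E\<close> lies below
    the trace.\<close>
  have "replace_at M q E \<in> \<L>"
  proof (rule layer_join[OF M(1) assms(2)])
    show "q \<in> fun_poss M" using C(2) C(3)[symmetric] unfolding fun_poss_def by simp
  qed (use E(1) C(3) in simp)
  moreover have "pref (replace_at M q E) C"
    using fills_replace_at[OF M(2) C(2) E(3)] C(4) by simp
  ultimately have "pref (replace_at M q E) M" using C(1) unfolding mtop_def by blast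
  from fills_subt_at[OF this, of q] have "pref E (Fun f ns)"
    using C(2,3) poss_replace_at[OF C(2)] subt_at_replace_at[OF C(2)] by simp
  then show ?thesis using E(2) pref_trans by blast
qed

section \<open>Rank\<close>

text \<open>Any top may witness the bound; by \<open>aliens_rank_le_Suc\<close> below the max-top is then a witness
  as well. The trivial top \<open>Hole\<close> makes the bounds monotone.\<close>

fun rank_le :: "nat \<Rightarrow> ('f, 'v) mctxt \<Rightarrow> bool" where
  "rank_le 0 s \<longleftrightarrow> False"
| "rank_le (Suc k) s \<longleftrightarrow> s \<in> terms F \<and> (\<exists>L \<in> \<L>. aliens (rank_le k) L s)"

lemma rank_le_terms: "rank_le k s \<Longrightarrow> s \<in> terms F"
  by (cases k) auto

lemma rank_le_SucI: "rank_le k s \<Longrightarrow> rank_le (Suc k) s"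
  using rank_le_terms Hole_layer by (auto intro!: bexI[of _ Hole])

lemma aliens_mono: "aliens P L s \<Longrightarrow> (\<And>u. P u \<Longrightarrow> P' u) \<Longrightarrow> aliens P' L s"
  by (erule fills_mono) auto

text \<open>Below a hole of \<open>L\<close>, the larger \<open>N\<close> continues as a trace
  inside an alien of \<open>L\<close>, and there the assumption applies.\<close>

lemma aliens_dominates:
  assumes "\<And>N u. P u \<Longrightarrow> dominates N u \<Longrightarrow> aliens P N u"
  shows "aliens P L u \<Longrightarrow> pref L N \<Longrightarrow> dominates N u \<Longrightarrow> aliens P N u"
proof (induction L arbitrary: N u)
  case Hole
  then show ?case using assms by simp
next
  case (Fun f ls)
  from Fun.prems(2) obtain ns where ns: "N = Fun f ns" "length ns = length ls"
    "\<And>i. i < length ls \<Longrightarrow> pref (ls ! i) (ns ! i)" by (rule pref_FunE) auto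
  from Fun.prems(1) obtain us where us: "u = Fun f us" "length us = length ls"
    "\<And>i. i < length ls \<Longrightarrow> aliens P (ls ! i) (us ! i)" by (rule fills_FunE) auto
  have "aliens P (ns ! i) (us ! i)" if "i < length ls" for i
    by (rule Fun.IH[OF nth_mem[OF that] us(3)[OF that] ns(3)[OF that]], rule dominates_args)
      (use Fun.prems(3) ns us that in auto)
  then show ?case using ns us by simp
qed auto

text \<open>By (L3) a trace rooted by a function symbol contains the top that witnesses the rank of
  \<open>u\<close>, so the rank drops. The weak bound for \<open>k\<close> is an assumption because
  the induction for \<open>aliens_rank_le\<close> calls this lemma.\<close>

lemma aliens_rank_le_strict:
  assumes "\<And>N u. rank_le k u \<Longrightarrow> dominates N u \<Longrightarrow> aliens (rank_le k) N u"
    and "rank_le (Suc k) u" "dominates N u" "N \<noteq> Hole"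
  shows "aliens (rank_le k) N u"
proof (cases N)
  case (Var x)
  then show ?thesis using dominates_pref[OF assms(3)] by simp
next
  case (Fun f ns)
  obtain L where L: "L \<in> \<L>" "aliens (rank_le k) L u" using assms(2) by auto
  have "pref L N"
    using dominates_top[OF _ L(1) fills_pref_left[OF L(2)], of f ns] assms(3) unfolding Fun by simp
  then show ?thesis using aliens_dominates[OF assms(1) L(2) _ assms(3)] by simp
qed (use assms(4) in simp)

text \<open>The rank can fail to drop only for the trace \<open>Hole\<close>, where the alien is
  \<open>u\<close> itself.\<close>

lemma aliens_rank_le: "rank_le k u \<Longrightarrow> dominates N u \<Longrightarrow> aliens (rank_le k) N u"
proof (induction k arbitrary: N u)
  case (Suc k)
  show ?case
  proof (cases "N = Hole")
    case True
    then show ?thesis using Suc.prems by simp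
  next
    case False
    have "aliens (rank_le k) N u" using Suc.IH Suc.prems False by (rule aliens_rank_le_strict)
    then show ?thesis by (rule aliens_mono) (rule rank_le_SucI)
  qed
qed simp

lemmas aliens_rank_le_Suc = aliens_rank_le_strict[OF aliens_rank_le]

section \<open>Rewriting a base context together with its term\<close>

abbreviation kept_or_cut :: "(('f, 'v) mctxt \<Rightarrow> bool) \<Rightarrow> (('f, 'v) mctxt \<Rightarrow> bool) \<Rightarrow>
    ('f, 'v) mctxt \<Rightarrow> ('f, 'v) mctxt \<Rightarrow> bool" where
  "kept_or_cut K U b u \<equiv> b = Hole \<and> U u \<or> b = u \<and> K u"

text \<open>A base context \<open>B\<close> of \<open>s\<close>: a top of \<open>s\<close> in which some aliens satisfying \<open>K\<close> are kept and all
  others, satisfying \<open>U\<close>, are cut off.\<close>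

definition base where
  "base K U B s \<longleftrightarrow> (\<exists>L \<in> \<L>. fills (kept_or_cut K U) L B s)"

text \<open>Since \<open>M\<close> dominates \<open>B\<close> rather than \<open>s\<close>, it has a
  hole wherever \<open>B\<close> has been cut. A kept alien is split by \<open>M\<close> into aliens
  of rank at most \<open>k\<close>.\<close>

lemma fills_dominates:
  "fills (kept_or_cut (rank_le k) U) L B s \<Longrightarrow> pref L M \<Longrightarrow> dominates M B \<Longrightarrow>
    fills (kept_or_cut (rank_le k) U) M B s"
proof (induction L arbitrary: M B s)
  case Hole
  show ?case
  proof (cases "B = Hole \<and> U s")
    case True
    then have "M = Hole" using dominates_pref[OF Hole(3)] by (cases M) (auto simp: fills_Fun)
    then show ?thesis using True by simp
  next
    case False
    then have "B = s" "rank_le k s" using Hole(1) by auto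
    from aliens_rank_le[OF this(2) Hole(3)[unfolded this(1)]] show ?thesis
      unfolding \<open>B = s\<close> by (rule fills_mono) simp
  qed
next
  case (Fun f ls)
  from Fun.prems(2) obtain ms where ms: "M = Fun f ms" "length ms = length ls"
    "\<And>i. i < length ls \<Longrightarrow> pref (ls ! i) (ms ! i)" by (rule pref_FunE) auto
  from Fun.prems(1) obtain bs ss where bs: "B = Fun f bs" "s = Fun f ss" "length bs = length ls"
    "length ss = length ls"
    "\<And>i. i < length ls \<Longrightarrow> fills (kept_or_cut (rank_le k) U) (ls ! i) (bs ! i) (ss ! i)" by (rule fills_FunE) auto
  have "fills (kept_or_cut (rank_le k) U) (ms ! i) (bs ! i) (ss ! i)" if "i < length ls" for i
    by (rule Fun.IH[OF nth_mem[OF that] bs(5)[OF that] ms(3)[OF that]], rule dominates_args)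
      (use Fun.prems(3) ms bs that in auto)
  then show ?case using ms bs by simp
qed auto

lemma step_outside:
  assumes "rl \<in> R" "\<And>b u b' u' q. Q b u \<Longrightarrow> rstep_at q rl b b' \<Longrightarrow> rstep_at q rl u u' \<Longrightarrow> Q b' u'"
  shows "fills Q M B s \<Longrightarrow> rstep_at p rl B B' \<Longrightarrow> rstep_at p rl s s' \<Longrightarrow> p \<notin> fun_poss M \<Longrightarrow>
    fills Q M B' s'"
proof (induction arbitrary: p B' s' rule: fills.induct)
  case (hole D E)
  then show ?case using assms(2) by auto
next
  case (var x)
  then show ?case using no_step_leaf[OF assms(1)] by blast
next
  case (app bs ms ss f)
  show ?case
  proof (cases p)
    case Nil
    then show ?thesis using app.prems(3) unfolding fun_poss_def by simp
  next
    case (Cons i q)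
    then obtain b' u' where i: "i < length ms" "rstep_at q rl (bs ! i) b'" "rstep_at q rl (ss ! i) u'"
      "B' = Fun f (bs[i := b'])" "s' = Fun f (ss[i := u'])"
      using app.prems(1,2) app.hyps by (auto simp: rstep_at_Cons)
    have "q \<notin> fun_poss (ms ! i)"
      using app.prems(3) i(1) unfolding fun_poss_def Cons by auto
    from app.IH[OF i(1-3) this] show ?thesis
      using i app.hyps by (auto simp: nth_list_update)
  qed
qed

text \<open>The max-top is that of \<open>B\<close>, not of \<open>s\<close>. If the step hits it,
  (W) supplies the new layer; otherwise the step lies in a kept alien, since the hole left by a cut
  one cannot be rewritten. \<open>K\<close> is an assumption so that \<open>rank_le_step\<close> can
  use the lemma, with nothing cut, inside its induction.\<close>

lemma base_step:
  assumes K: "\<And>u u' p. rank_le k u \<Longrightarrow> rstep_at p rl u u' \<Longrightarrow> rank_le k u'"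
    and B: "B \<in> contexts F" "base (rank_le k) U B s"
    and rl: "rl \<in> R" and steps: "rstep_at p rl B B'" "rstep_at p rl s s'"
  shows "base (rank_le k) U B' s'"
proof -
  obtain L where L: "L \<in> \<L>" "fills (kept_or_cut (rank_le k) U) L B s" using B(2) unfolding base_def by blast
  obtain M where M: "mtop B M" using mtop_exists[OF B(1)] by blast
  then have "pref L M" using L(1) fills_pref_left[OF L(2)] unfolding mtop_def by blast
  from fills_dominates[OF L(2) this mtop_dominates[OF M]]
  have f: "fills (kept_or_cut (rank_le k) U) M B s" .
  show ?thesis
  proof (cases "p \<in> fun_poss M")
    case True
    from mtop_step[OF M rl steps(1) True] obtain N where N: "N \<in> \<L>" "rstep_at p rl M N" by blast
    from rstep_at_fills[OF rules(1-4)[OF rl] f N(2)]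
    obtain D E where "rstep_at p rl B D" "rstep_at p rl s E" "fills (kept_or_cut (rank_le k) U) N D E"
      by blast
    moreover from this have "D = B'" "E = s'"
      using rstep_at_det[OF rules(3)[OF rl]] steps by blast+
    ultimately show ?thesis using N(1) unfolding base_def by blast
  next
    case False
    have "fills (kept_or_cut (rank_le k) U) M B' s'"
    proof (rule step_outside[OF rl _ f steps False])
      fix b u b' u' q
      assume "kept_or_cut (rank_le k) U b u" and s: "rstep_at q rl b b'" "rstep_at q rl u u'"
      then have "b = u" "rank_le k u" using no_step_leaf(1)[OF rl] by auto
      then show "kept_or_cut (rank_le k) U b' u'"
        using K[OF _ s(2)] rstep_at_det[OF rules(3)[OF rl] s(2), of b'] s(1) by simp
    qed
    then show ?thesis using M unfolding base_def mtop_def by blast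
  qed
qed

lemma rank_le_Suc_base: "rank_le (Suc k) s \<longleftrightarrow> s \<in> terms F \<and> base (rank_le k) (\<lambda>_. False) s s"
  unfolding base_def by simp

lemma rank_le_step: "rl \<in> R \<Longrightarrow> rank_le k s \<Longrightarrow> rstep_at p rl s t \<Longrightarrow> rank_le k t"
proof (induction k arbitrary: s t p)
  case (Suc k)
  have s: "s \<in> terms F" "base (rank_le k) (\<lambda>_. False) s s" using Suc.prems(2) rank_le_Suc_base by blast+
  have "t \<in> terms F" using rstep_at_terms[OF rules(2,3)[OF Suc.prems(1)] Suc.prems(3) s(1)] .
  moreover have "base (rank_le k) (\<lambda>_. False) t t"
    by (rule base_step[OF Suc.IH[OF Suc.prems(1)] terms_contexts[OF s(1)] s(2) Suc.prems(1,3,3)])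
  ultimately show ?case using rank_le_Suc_base by blast
qed simp

section \<open>Every term has a rank\<close>

lemma rank_le_mono: "k \<le> n \<Longrightarrow> rank_le k s \<Longrightarrow> rank_le n s"
  by (induction rule: dec_induct) (simp_all only: rank_le_SucI)

text \<open>An alien is all of \<open>t\<close> only if \<open>L\<close> is \<open>Hole\<close>; the
  disjunct for this case lets the induction reach arguments where the layer ends.\<close>

lemma aliens_rank_le_exists:
  assumes "pref L t" "t \<in> terms F"
    and "\<And>u. u \<in> terms F \<Longrightarrow> size u < size t \<or> L = Hole \<and> u = t \<Longrightarrow> \<exists>n. rank_le n u"
  shows "\<exists>n. aliens (rank_le n) L t"
  using assms
proof (induction L arbitrary: t)
  case (Fun f ls)
  from Fun.prems(1) obtain ts where ts: "t = Fun f ts" "length ts = length ls"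
    "\<And>i. i < length ls \<Longrightarrow> pref (ls ! i) (ts ! i)" by (rule pref_FunE) auto
  have "\<exists>n. aliens (rank_le n) (ls ! i) (ts ! i)" if i: "i < length ls" for i
  proof (rule Fun.IH[OF nth_mem[OF i] ts(3)[OF i]])
    show "ts ! i \<in> terms F" using Fun.prems(2) ts i by (simp add: terms_Fun)
    have "size (ts ! i) < size t" using size_nth_less[of i ts] ts i by simp
    then show "\<exists>n. rank_le n u" if "u \<in> terms F" "size u < size (ts ! i) \<or> ls ! i = Hole \<and> u = ts ! i" for u
      by (intro Fun.prems(3)) (use that in auto)
  qed
  then have "\<forall>i. \<exists>n. i < length ls \<longrightarrow> aliens (rank_le n) (ls ! i) (ts ! i)" by blast
  then obtain n where n: "\<forall>i. i < length ls \<longrightarrow> aliens (rank_le (n i)) (ls ! i) (ts ! i)"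
    by (drule_tac choice) blast
  let ?m = "sum n {..<length ls}"
  have "aliens (rank_le ?m) (ls ! i) (ts ! i)" if "i < length ls" for i
  proof (rule aliens_mono)
    show "aliens (rank_le (n i)) (ls ! i) (ts ! i)" using n that by blast
    have "n i \<le> ?m" by (rule member_le_sum) (use that in simp_all)
    then show "rank_le (n i) u \<Longrightarrow> rank_le ?m u" for u by (rule rank_le_mono)
  qed
  then have "aliens (rank_le ?m) (Fun f ls) t" using ts by simp
  then show ?case by (rule exI)
qed auto

lemma rank_le_exists: "t \<in> terms F \<Longrightarrow> \<exists>n. rank_le n t"
proof (induction "size t" arbitrary: t rule: less_induct)
  case less
  obtain L where L: "L \<in> \<L>" "pref L t" "L \<noteq> Hole"
    using layer_nontrivial_top[OF less.prems] by blast
  have "\<exists>n. aliens (rank_le n) L t"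
    by (rule aliens_rank_le_exists[OF L(2) less.prems]) (use less.hyps L(3) in blast)
  then obtain n where "aliens (rank_le n) L t" ..
  then have "rank_le (Suc n) t" using L(1) less.prems by auto
  then show ?case ..
qed

section \<open>Decomposed rewriting\<close>

text \<open>The pair consists of a base context and the whole term. Contracting the same redex in
  both keeps track of the decomposition.\<close>

definition pair_step :: "('f, 'v) mctxt \<times> ('f, 'v) mctxt \<Rightarrow> ('f, 'v) mctxt \<times> ('f, 'v) mctxt \<Rightarrow> bool" where
  "pair_step x y \<longleftrightarrow> (\<exists>p. \<exists>rl \<in> R. rstep_at p rl (fst x) (fst y) \<and> rstep_at p rl (snd x) (snd y))"

abbreviation rsteps where "rsteps \<equiv> (rstep R)\<^sup>*\<^sup>*"

lemma pair_steps_diag: "rsteps s t \<Longrightarrow> pair_step\<^sup>*\<^sup>* (s, s) (t, t)"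
proof (induction rule: rtranclp_induct)
  case (step t u)
  then have "pair_step (t, t) (u, u)" unfolding pair_step_def rstep_def by auto
  with step.IH show ?case by (rule rtranclp.rtrancl_into_rtrancl)
qed simp

lemma pair_steps_snd: "pair_step\<^sup>*\<^sup>* x y \<Longrightarrow> rsteps (snd x) (snd y)"
proof (induction rule: rtranclp_induct)
  case (step y z)
  then have "rstep R (snd y) (snd z)" unfolding pair_step_def rstep_def by auto
  with step.IH show ?case by (rule rtranclp.rtrancl_into_rtrancl)
qed simp

lemma pair_steps_arg:
  assumes "pair_step\<^sup>*\<^sup>* (b, s) y" "i < length bs" "i < length ss"
  shows "pair_step\<^sup>*\<^sup>* (Fun f (bs[i := b]), Fun f (ss[i := s])) (Fun f (bs[i := fst y]), Fun f (ss[i := snd y]))"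
  using assms(1)
proof (induction rule: rtranclp_induct)
  case (step y z)
  then obtain p rl where p: "rl \<in> R" "rstep_at p rl (fst y) (fst z)" "rstep_at p rl (snd y) (snd z)"
    unfolding pair_step_def by blast
  then have "pair_step (Fun f (bs[i := fst y]), Fun f (ss[i := snd y]))
      (Fun f (bs[i := fst z]), Fun f (ss[i := snd z]))"
    unfolding pair_step_def
    by (intro exI[of _ "i # p"] bexI[of _ rl]) (auto simp: rstep_at_Cons assms)
  with step.IH show ?case by (rule rtranclp.rtrancl_into_rtrancl)
qed simp

lemma pair_steps_args:
  assumes len: "length ss = length bs" "length cs = length bs" "length ts = length bs"
    and "\<And>i. i < length bs \<Longrightarrow> pair_step\<^sup>*\<^sup>* (bs ! i, ss ! i) (cs ! i, ts ! i)"
  shows "pair_step\<^sup>*\<^sup>* (Fun f bs, Fun f ss) (Fun f cs, Fun f ts)"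
proof -
  have "pair_step\<^sup>*\<^sup>* (Fun f bs, Fun f ss) (Fun f (take n cs @ drop n bs), Fun f (take n ts @ drop n ss))"
    if "n \<le> length bs" for n
    using that
  proof (induction n)
    case (Suc n)
    have n: "n < length bs" using Suc.prems by simp
    let ?b = "take n cs @ drop n bs" and ?s = "take n ts @ drop n ss"
    have "pair_step\<^sup>*\<^sup>* (Fun f (?b[n := bs ! n]), Fun f (?s[n := ss ! n]))
        (Fun f (?b[n := fst (cs ! n, ts ! n)]), Fun f (?s[n := snd (cs ! n, ts ! n)]))"
      by (rule pair_steps_arg[OF assms(4)[OF n]]) (use n len in auto)
    moreover have "?b[n := bs ! n] = ?b" "?s[n := ss ! n] = ?s"
      using n len by (auto simp: list_update_append Cons_nth_drop_Suc[symmetric])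
    moreover have "?b[n := cs ! n] = take (Suc n) cs @ drop (Suc n) bs"
      "?s[n := ts ! n] = take (Suc n) ts @ drop (Suc n) ss"
      using n len by (auto simp: list_update_append Cons_nth_drop_Suc[symmetric] take_Suc_conv_app_nth)
    ultimately show ?case using Suc.IH n by (auto intro: rtranclp_trans)
  qed simp
  from this[of "length bs"] show ?thesis using len by simp
qed

lemma fills_rsteps: "fills rsteps B s t \<Longrightarrow> rsteps s t"
proof (induction rule: fills.induct)
  case (app ss bs ts f)
  have "pair_step\<^sup>*\<^sup>* (Fun f ss, Fun f ss) (Fun f ts, Fun f ts)"
    by (rule pair_steps_args) (use app pair_steps_diag in auto)
  from pair_steps_snd[OF this] show ?case by simp
qed auto

lemma rank_le_rsteps:
  assumes "rank_le k s" "rsteps s t" shows "rank_le k t"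
  using assms(2,1)
proof (induction rule: rtranclp_induct)
  case (step t u)
  then show ?case unfolding rstep_def using rank_le_step by blast
qed

lemma terms_rsteps:
  assumes "s \<in> terms F" "rsteps s t" shows "t \<in> terms F"
  using rank_le_exists[OF assms(1)] rank_le_rsteps[OF _ assms(2)] rank_le_terms by blast

text \<open>\<open>D\<close> lies between \<open>B\<close> and \<open>s\<close>, so it can follow
  every step of \<open>B\<close>: base steps remain base steps for a larger base context.\<close>

lemma fills_pair_steps_middle:
  assumes "pair_step\<^sup>*\<^sup>* (B, s) y" "fills Q B D s"
  shows "\<exists>D'. pair_step\<^sup>*\<^sup>* (D, s) (D', snd y) \<and> fills Q (fst y) D' (snd y)"
  using assms(1)
proof (induction rule: rtranclp_induct)
  case base
  then show ?case using assms(2) by auto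
next
  case (step y z)
  obtain D' where D': "pair_step\<^sup>*\<^sup>* (D, s) (D', snd y)" "fills Q (fst y) D' (snd y)" using step.IH by blast
  from step.hyps(2) obtain p rl where p: "rl \<in> R" "rstep_at p rl (fst y) (fst z)"
    "rstep_at p rl (snd y) (snd z)" unfolding pair_step_def by blast
  from rstep_at_fills[OF rules(1-4)[OF p(1)] D'(2) p(2)]
  obtain D'' s' where D'': "rstep_at p rl D' D''" "rstep_at p rl (snd y) s'" "fills Q (fst z) D'' s'"
    by blast
  have "s' = snd z" using rstep_at_det[OF rules(3)[OF p(1)] D''(2) p(3)] .
  moreover have "pair_step (D', snd y) (D'', snd z)" using p(1,3) D''(1) unfolding pair_step_def by auto
  ultimately show ?case using D'(1) D''(3) by (auto intro: rtranclp.rtrancl_into_rtrancl)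
qed

text \<open>Base steps commute with tall ones: their redexes lie in \<open>B\<close>, so refilling
  the holes of \<open>B\<close> does not disturb them.\<close>

lemma fills_pair_steps_right:
  assumes "pair_step\<^sup>*\<^sup>* (B, s) y" "fills Q B s t"
  shows "\<exists>t'. pair_step\<^sup>*\<^sup>* (B, t) (fst y, t') \<and> fills Q (fst y) (snd y) t'"
  using assms(1)
proof (induction rule: rtranclp_induct)
  case base
  then show ?case using assms(2) by auto
next
  case (step y z)
  obtain t' where t': "pair_step\<^sup>*\<^sup>* (B, t) (fst y, t')" "fills Q (fst y) (snd y) t'" using step.IH by blast
  from step.hyps(2) obtain p rl where p: "rl \<in> R" "rstep_at p rl (fst y) (fst z)"
    "rstep_at p rl (snd y) (snd z)" unfolding pair_step_def by blast
  from rstep_at_fills[OF rules(1-4)[OF p(1)] t'(2) p(2)]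
  obtain s' t'' where t'': "rstep_at p rl (snd y) s'" "rstep_at p rl t' t''" "fills Q (fst z) s' t''"
    by blast
  have "s' = snd z" using rstep_at_det[OF rules(3)[OF p(1)] t''(1) p(3)] .
  moreover have "pair_step (fst y, t') (fst z, t'')" using p(1,2) t''(2) unfolding pair_step_def by auto
  ultimately show ?case using t'(1) t''(3) by (auto intro: rtranclp.rtrancl_into_rtrancl)
qed

lemma pair_steps_subst: "rsteps C D \<Longrightarrow> pair_step\<^sup>*\<^sup>* (subst \<sigma> C, subst \<tau> C) (subst \<sigma> D, subst \<tau> D)"
proof (induction rule: rtranclp_induct)
  case (step C D)
  then have "pair_step (subst \<sigma> C, subst \<tau> C) (subst \<sigma> D, subst \<tau> D)"
    unfolding rstep_def pair_step_def using rstep_at_subst by fastforce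
  with step.IH show ?case by (rule rtranclp.rtrancl_into_rtrancl)
qed simp

text \<open>Meant for \<open>C\<close> obtained from \<open>B\<close> by putting fresh variables
  into the holes: rewriting the pair becomes rewriting one term, from which \<open>\<sigma>\<close>
  and \<open>\<tau>\<close> recover both components.\<close>

lemma pair_steps_unsubst:
  assumes "pair_step\<^sup>*\<^sup>* (B, s) y" "fills Q B s C" "subst \<sigma> C = B" "subst \<tau> C = s"
  shows "\<exists>D. rsteps C D \<and> subst \<sigma> D = fst y \<and> subst \<tau> D = snd y \<and> fills Q (fst y) (snd y) D"
  using assms(1)
proof (induction rule: rtranclp_induct)
  case base
  then show ?case using assms(2-4) by auto
next
  case (step y z)
  obtain D where D: "rsteps C D" "subst \<sigma> D = fst y" "subst \<tau> D = snd y" "fills Q (fst y) (snd y) D"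
    using step.IH by blast
  from step.hyps(2) obtain p rl where p: "rl \<in> R" "rstep_at p rl (fst y) (fst z)"
    "rstep_at p rl (snd y) (snd z)" unfolding pair_step_def by blast
  from rstep_at_fills[OF rules(1-4)[OF p(1)] D(4) p(2)]
  obtain s' E where E: "rstep_at p rl (snd y) s'" "rstep_at p rl D E" "fills Q (fst z) s' E"
    by blast
  note det = rstep_at_det[OF rules(3)[OF p(1)]]
  have "s' = snd z" using det E(1) p(3) by blast
  moreover have "subst \<sigma> E = fst z" using det rstep_at_subst[OF E(2), of \<sigma>] p(2) unfolding D(2) by blast
  moreover have "subst \<tau> E = snd z" using det rstep_at_subst[OF E(2), of \<tau>] p(3) unfolding D(3) by blast
  moreover have "rstep R D E" using E(2) p(1) unfolding rstep_def by blast
  then have "rsteps C E" by (rule rtranclp.rtrancl_into_rtrancl[OF D(1)])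
  ultimately show ?case using E(3) by blast
qed

section \<open>Tall and base steps\<close>

declare rank_le.simps(2) [simp del]

definition confl :: "(('f, 'v) mctxt \<Rightarrow> bool) \<Rightarrow> bool" where
  "confl P \<longleftrightarrow> (\<forall>s t u. P s \<longrightarrow> rsteps s t \<longrightarrow> rsteps s u \<longrightarrow> (\<exists>w. rsteps t w \<and> rsteps u w))"

abbreviation tall_cut :: "nat \<Rightarrow> ('f, 'v) mctxt \<Rightarrow> ('f, 'v) mctxt \<Rightarrow> bool" where
  "tall_cut k b u \<equiv> (if rank_le k u then b = u else b = Hole \<and> rank_le (Suc k) u)"

text \<open>The maximal base context: take the max-top and cut off precisely the tall aliens, those of
  rank exactly \<open>Suc k\<close>.\<close>

definition max_base :: "nat \<Rightarrow> ('f, 'v) mctxt \<Rightarrow> ('f, 'v) mctxt \<Rightarrow> bool" where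
  "max_base k C s \<longleftrightarrow> (\<exists>M. mtop s M \<and> fills (tall_cut k) M C s)"

abbreviation base_of :: "nat \<Rightarrow> ('f, 'v) mctxt \<Rightarrow> ('f, 'v) mctxt \<Rightarrow> bool" where
  "base_of k \<equiv> base (rank_le k) (rank_le (Suc k))"

lemma max_base_imp_base: "max_base k C s \<Longrightarrow> base_of k C s"
  unfolding max_base_def base_def mtop_def
  by (auto split: if_splits elim!: fills_mono intro!: bexI)

lemma max_base_exists:
  assumes "rank_le (Suc (Suc k)) s"
  shows "\<exists>C. max_base k C s"
proof -
  have s: "s \<in> terms F" by (rule rank_le_terms[OF assms])
  obtain M where M: "mtop s M" using mtop_exists[OF terms_contexts[OF s]] by blast
  \<comment> \<open>(L1) excludes the trivial max-top, so the aliens of \<open>s\<close> have rank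
    at most \<open>Suc k\<close>.\<close>
  obtain L where L: "L \<in> \<L>" "pref L s" "L \<noteq> Hole" using layer_nontrivial_top[OF s] by blast
  have "pref L M" using M L unfolding mtop_def by blast
  then have "M \<noteq> Hole" using L(3) by (cases L) (auto simp: fills_Fun)
  from aliens_rank_le_Suc[OF _ _ assms mtop_dominates[OF M] this]
  have "aliens (rank_le (Suc k)) M s" by simp
  then have "\<exists>C. fills (\<lambda>u b. tall_cut k b u) M s C" by (rule fills_choice[rotated]) auto
  then obtain C where "fills (\<lambda>u b. tall_cut k b u) M s C" ..
  from fills_flip[OF this] show ?thesis using M unfolding max_base_def by blast
qed

lemma base_of_terms: "s \<in> terms F \<Longrightarrow> base_of k B s \<Longrightarrow> rank_le (Suc (Suc k)) s"
  unfolding base_def rank_le.simps(2)[of "Suc k" s]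
proof (elim bexE, intro conjI bexI)
  fix L assume "fills (kept_or_cut (rank_le k) (rank_le (Suc k))) L B s"
  then show "aliens (rank_le (Suc k)) L s"
  proof (induction rule: fills.induct)
    case (hole b u)
    then have "rank_le (Suc k) u" using rank_le_SucI[of k u] by blast
    then show ?case by (simp only: fills_Hole simp_thms)
  qed auto
qed

lemma base_pref:
  assumes "base_of k B s" shows "pref B s"
proof -
  obtain L where "fills (kept_or_cut (rank_le k) (rank_le (Suc k))) L B s" using assms unfolding base_def by blast
  then show ?thesis by (induction rule: fills.induct) (auto intro: fills_refl)
qed

lemma base_pair_steps:
  assumes "pair_step\<^sup>*\<^sup>* (B, s) y" "base_of k B s" "s \<in> terms F"
  shows "base_of k (fst y) (snd y) \<and> snd y \<in> terms F"
  using assms(1)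
proof (induction rule: rtranclp_induct)
  case base
  then show ?case using assms(2,3) by simp
next
  case (step y z)
  then have y: "base_of k (fst y) (snd y)" "snd y \<in> terms F" by auto
  from step.hyps(2) obtain p rl where p: "rl \<in> R" "rstep_at p rl (fst y) (fst z)"
    "rstep_at p rl (snd y) (snd z)" unfolding pair_step_def by blast
  have c: "fst y \<in> contexts F" by (rule pref_contexts[OF base_pref[OF y(1)] terms_contexts[OF y(2)]])
  have "base_of k (fst z) (snd z)"
    by (rule base_step[OF rank_le_step[OF p(1)] c y(1) p(1,2,3)])
  moreover have "snd z \<in> terms F" by (rule rstep_at_terms[OF rules(2,3)[OF p(1)] p(3) y(2)])
  ultimately show ?case by blast
qed

lemma fills_aliens_full:
  "fills (tall_cut k) M C s \<Longrightarrow> aliens (rank_le k) M s \<Longrightarrow> C = s"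
proof (induction rule: fills.induct)
  case (app cs ms ss f)
  then show ?case by (auto intro: nth_equalityI)
qed (auto)

text \<open>Passing from an arbitrary base context to the maximal one, each hole either stays or is
  filled completely: an alien that melts into the max-top has no tall aliens of its own.\<close>

lemma base_refine:
  "fills (kept_or_cut (rank_le k) (rank_le (Suc k))) L B s \<Longrightarrow> pref L M \<Longrightarrow> dominates M s \<Longrightarrow>
    fills (tall_cut k) M C s \<Longrightarrow>
    fills (\<lambda>c u. c = Hole \<or> c = u) B C s"
proof (induction L arbitrary: M B C s)
  case Hole
  have rank_le: "rank_le (Suc k) s" using Hole.prems(1) rank_le_SucI[of k s] unfolding fills_Hole by blast
  show ?case
  proof (cases "M = Hole")
    case True
    then show ?thesis using Hole.prems(1,4) by (auto intro: fills_refl split: if_splits)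
  next
    case False
    have "aliens (rank_le k) M s" by (rule aliens_rank_le_Suc[OF _ _ rank_le Hole.prems(3) False])
    then have "C = s" by (rule fills_aliens_full[OF Hole.prems(4)])
    then show ?thesis using Hole.prems(1) by (auto intro: fills_refl)
  qed
next
  case (Fun f ls)
  from Fun.prems(2) obtain ms where ms: "M = Fun f ms" "length ms = length ls"
    "\<And>i. i < length ls \<Longrightarrow> pref (ls ! i) (ms ! i)" by (rule pref_FunE) auto
  from Fun.prems(1) obtain bs ss where bs: "B = Fun f bs" "s = Fun f ss" "length bs = length ls"
    "length ss = length ls"
    "\<And>i. i < length ls \<Longrightarrow> fills (kept_or_cut (rank_le k) (rank_le (Suc k))) (ls ! i) (bs ! i) (ss ! i)"
    by (rule fills_FunE) (auto)
  from Fun.prems(4)[unfolded ms(1)] obtain cs where cs: "C = Fun f cs" "length cs = length ls"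
    "\<And>i. i < length ls \<Longrightarrow> fills (tall_cut k) (ms ! i) (cs ! i) (ss ! i)"
    by (rule fills_FunE) (use ms bs in auto)
  have "fills (\<lambda>c u. c = Hole \<or> c = u) (bs ! i) (cs ! i) (ss ! i)" if "i < length ls" for i
    by (rule Fun.IH[OF nth_mem[OF that] bs(5)[OF that] ms(3)[OF that] _ cs(3)[OF that]], rule dominates_args)
      (use Fun.prems(3) ms bs that in auto)
  then show ?case using bs cs by simp
qed auto

lemma max_base_refines:
  assumes "base_of k B s" "max_base k C s"
  shows "fills (\<lambda>c u. c = Hole \<or> c = u) B C s"
proof -
  obtain L where L: "L \<in> \<L>" "fills (kept_or_cut (rank_le k) (rank_le (Suc k))) L B s"
    using assms(1) unfolding base_def by blast
  obtain M where M: "mtop s M" "fills (tall_cut k) M C s" using assms(2) unfolding max_base_def by blast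
  have "pref L s" using fills_pref_right[OF L(2)] .
  then have "pref L M" using M(1) L(1) unfolding mtop_def by blast
  then show ?thesis by (rule base_refine[OF L(2) _ mtop_dominates[OF M(1)] M(2)])
qed

section \<open>Base and tall rewriting as relations on terms\<close>

definition canon :: "nat \<Rightarrow> ('f, 'v) mctxt \<Rightarrow> ('f, 'v) mctxt" where
  "canon k s = (SOME C. max_base k C s)"

lemma canon: "rank_le (Suc (Suc k)) s \<Longrightarrow> max_base k (canon k s) s"
  unfolding canon_def by (rule someI_ex[OF max_base_exists])

text \<open>Any base context may serve, because its steps are also steps for the canonical one
  (\<open>base_rel_canon\<close>).\<close>

definition base_rel :: "nat \<Rightarrow> ('f, 'v) mctxt \<Rightarrow> ('f, 'v) mctxt \<Rightarrow> bool" where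
  "base_rel k s t \<longleftrightarrow> s \<in> terms F \<and> (\<exists>B B'. base_of k B s \<and> pair_step\<^sup>*\<^sup>* (B, s) (B', t))"

text \<open>Tied to the canonical base context, so that two tall steps of a term rewrite the same
  aliens. With \<open>rsteps\<close> in each hole, confluence of the aliens closes a peak at
  once.\<close>

definition tall_rel :: "nat \<Rightarrow> ('f, 'v) mctxt \<Rightarrow> ('f, 'v) mctxt \<Rightarrow> bool" where
  "tall_rel k s t \<longleftrightarrow> rank_le (Suc (Suc k)) s \<and> fills rsteps (canon k s) s t"

lemma base_rel_canon:
  assumes "base_rel k s t"
  shows "\<exists>C. base_of k (canon k s) s \<and> pair_step\<^sup>*\<^sup>* (canon k s, s) (C, t) \<and> rank_le (Suc (Suc k)) s"
proof -
  obtain B B' where B: "s \<in> terms F" "base_of k B s" "pair_step\<^sup>*\<^sup>* (B, s) (B', t)"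
    using assms unfolding base_rel_def by blast
  have rank_le: "rank_le (Suc (Suc k)) s" by (rule base_of_terms[OF B(1,2)])
  note C = canon[OF rank_le]
  from fills_pair_steps_middle[OF B(3) max_base_refines[OF B(2) C]]
  show ?thesis using max_base_imp_base[OF C] rank_le by auto
qed

text \<open>The layer is untouched: kept aliens are terms without holes to rewrite in, and cut ones
  keep their rank bound.\<close>

lemma base_fills:
  assumes "base_of k B s" "s \<in> terms F" "fills rsteps B s t"
  shows "base_of k B t"
proof -
  obtain L where L: "L \<in> \<L>" "fills (kept_or_cut (rank_le k) (rank_le (Suc k))) L B s"
    using assms(1) unfolding base_def by blast
  have "fills (kept_or_cut (rank_le k) (rank_le (Suc k))) L B t" using L(2) assms(2,3)
  proof (induction arbitrary: t rule: fills.induct)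
    case (hole b u)
    show ?case
    proof (cases "b = Hole")
      case True
      then have "rank_le (Suc k) t" using hole rank_le_rsteps[of "Suc k" u t] by auto
      then show ?thesis using True by (simp only: fills_Hole simp_thms)
    next
      case False
      then have "b = u" "rank_le k u" using hole.hyps by auto
      then show ?thesis using hole.prems fills_term[of u F rsteps u t] by simp
    qed
  next
    case (app bs ls ss f)
    from app.prems(2) obtain ts where ts: "t = Fun f ts" "length ts = length bs"
      "\<And>i. i < length bs \<Longrightarrow> fills rsteps (bs ! i) (ss ! i) (ts ! i)"
      by (rule fills_FunE) auto
    then show ?case using app by (simp add: terms_Fun)
  qed auto
  then show ?thesis using L(1) unfolding base_def by blast
qed

text \<open>A hole of \<open>B\<close> still open in \<open>C\<close> is rewritten at once. A hole
  filled with its alien is left alone in \<open>v\<close> and rewritten afterwards, in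
  \<open>C\<close> and \<open>v\<close> alike, since both carry that alien there.\<close>

lemma tall_split:
  "fills (\<lambda>c u. c = Hole \<or> c = u) B C s \<Longrightarrow> fills rsteps B s t \<Longrightarrow>
    \<exists>v D. fills rsteps C s v \<and> pair_step\<^sup>*\<^sup>* (C, v) (D, t)"
proof (induction arbitrary: t rule: fills.induct)
  case (hole c u)
  then have ut: "rsteps u t" by simp
  show ?case
  proof (cases "c = Hole")
    case True
    then show ?thesis using ut by auto
  next
    case False
    then have "c = u" using hole by simp
    then have "fills rsteps c u u" by (auto intro: fills_refl)
    then show ?thesis using pair_steps_diag[OF ut] \<open>c = u\<close> by blast
  qed
next
  case (var x)
  then show ?case by auto
next
  case (app cs bs ss f)
  from app.prems obtain ts where ts: "t = Fun f ts" "length ts = length bs"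
    "\<And>i. i < length bs \<Longrightarrow> fills rsteps (bs ! i) (ss ! i) (ts ! i)"
    by (rule fills_FunE) auto
  have "\<forall>i. \<exists>vD. i < length bs \<longrightarrow>
      fills rsteps (cs ! i) (ss ! i) (fst vD) \<and> pair_step\<^sup>*\<^sup>* (cs ! i, fst vD) (snd vD, ts ! i)"
    using app.IH ts(3) by fastforce
  from choice[OF this] obtain vD where vD: "\<And>i. i < length bs \<Longrightarrow>
      fills rsteps (cs ! i) (ss ! i) (fst (vD i)) \<and>
      pair_step\<^sup>*\<^sup>* (cs ! i, fst (vD i)) (snd (vD i), ts ! i)"
    by blast
  let ?vs = "map (\<lambda>i. fst (vD i)) [0..<length bs]" and ?ds = "map (\<lambda>i. snd (vD i)) [0..<length bs]"
  have "fills rsteps (Fun f cs) (Fun f ss) (Fun f ?vs)" using app.hyps vD by simp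
  moreover have "pair_step\<^sup>*\<^sup>* (Fun f cs, Fun f ?vs) (Fun f ?ds, Fun f ts)"
    by (rule pair_steps_args) (use app.hyps ts vD in auto)
  ultimately show ?case using ts(1) by blast
qed

lemma tall_transfer:
  assumes "base_of k B s" "s \<in> terms F" "fills rsteps B s t"
  shows "\<exists>v. tall_rel k s v \<and> base_rel k v t"
proof -
  have rank_le: "rank_le (Suc (Suc k)) s" by (rule base_of_terms[OF assms(2,1)])
  note C = canon[OF rank_le]
  from tall_split[OF max_base_refines[OF assms(1) C] assms(3)]
  obtain v D where v: "fills rsteps (canon k s) s v" "pair_step\<^sup>*\<^sup>* (canon k s, v) (D, t)" by blast
  have "base_of k (canon k s) v" by (rule base_fills[OF max_base_imp_base[OF C] assms(2) v(1)])
  moreover have "v \<in> terms F" by (rule terms_rsteps[OF assms(2) fills_rsteps[OF v(1)]])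
  ultimately show ?thesis using rank_le v unfolding tall_rel_def base_rel_def by blast
qed

lemma base_aliens:
  assumes "base_of k B s" "s \<in> terms F"
  shows "aliens (rank_le (Suc k)) B s"
proof -
  obtain L where "fills (kept_or_cut (rank_le k) (rank_le (Suc k))) L B s" using assms(1) unfolding base_def by blast
  then show ?thesis using assms(2)
  proof (induction rule: fills.induct)
    case (hole b u)
    then show ?case by (auto simp: fills_term)
  qed (auto simp: terms_Fun)
qed

section \<open>Local peaks\<close>

lemma fills_join:
  assumes "confl U"
  shows "aliens U C s \<Longrightarrow> fills rsteps C s t \<Longrightarrow> fills rsteps C s u \<Longrightarrow>
    \<exists>w. fills rsteps C t w \<and> fills rsteps C u w"
proof (induction C arbitrary: s t u)
  case Hole
  then show ?case using assms unfolding confl_def by auto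
next
  case (Fun f cs)
  from Fun.prems(2) obtain ss ts where ts: "s = Fun f ss" "t = Fun f ts" "length ss = length cs"
    "length ts = length cs" "\<And>i. i < length cs \<Longrightarrow> fills rsteps (cs ! i) (ss ! i) (ts ! i)"
    by (rule fills_FunE) auto
  from Fun.prems(3) obtain us where us: "u = Fun f us" "length us = length cs"
    "\<And>i. i < length cs \<Longrightarrow> fills rsteps (cs ! i) (ss ! i) (us ! i)"
    by (rule fills_FunE) (use ts in auto)
  have "\<forall>i. \<exists>w. i < length cs \<longrightarrow> fills rsteps (cs ! i) (ts ! i) w \<and> fills rsteps (cs ! i) (us ! i) w"
    using Fun.IH[OF nth_mem _ ts(5) us(3)] Fun.prems(1) ts(1) by auto
  from choice[OF this] obtain w where "\<And>i. i < length cs \<Longrightarrow>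
      fills rsteps (cs ! i) (ts ! i) (w i) \<and> fills rsteps (cs ! i) (us ! i) (w i)" by blast
  then show ?case
    using ts us by (intro exI[of _ "Fun f (map w [0..<length cs])"]) simp
qed auto

text \<open>\<open>?C\<close> is still a base context of \<open>y\<close> and \<open>z\<close>,
  though perhaps no longer the canonical one; \<open>tall_transfer\<close> makes up for this by base
  steps.\<close>

lemma tall_tall:
  assumes "confl (rank_le (Suc k))" "tall_rel k x y" "tall_rel k x z"
  shows "\<exists>y' z' w. tall_rel k y y' \<and> base_rel k y' w \<and> tall_rel k z z' \<and> base_rel k z' w"
proof -
  let ?C = "canon k x"
  have x: "rank_le (Suc (Suc k)) x" "fills rsteps ?C x y" "fills rsteps ?C x z"
    using assms(2,3) unfolding tall_rel_def by auto
  have b: "base_of k ?C x" by (rule max_base_imp_base[OF canon[OF x(1)]])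
  have t: "x \<in> terms F" by (rule rank_le_terms[OF x(1)])
  obtain w where w: "fills rsteps ?C y w" "fills rsteps ?C z w"
    using fills_join[OF assms(1) base_aliens[OF b t] x(2,3)] by blast
  have "y \<in> terms F" "z \<in> terms F" using terms_rsteps[OF t] fills_rsteps x(2,3) by blast+
  then show ?thesis
    using tall_transfer[OF base_fills[OF b t x(2)] _ w(1)] tall_transfer[OF base_fills[OF b t x(3)] _ w(2)]
    by blast
qed

text \<open>The base step turns \<open>?C\<close> into a base context \<open>C\<close> of
  \<open>z\<close> that need not be canonical, hence the final base step after
  \<open>z'\<close>.\<close>

lemma tall_base:
  assumes "tall_rel k x y" "base_rel k x z"
  shows "\<exists>w z'. base_rel k y w \<and> tall_rel k z z' \<and> base_rel k z' w"
proof -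
  let ?C = "canon k x"
  obtain C where C: "base_of k ?C x" "pair_step\<^sup>*\<^sup>* (?C, x) (C, z)" "rank_le (Suc (Suc k)) x"
    using base_rel_canon[OF assms(2)] by blast
  have y: "fills rsteps ?C x y" using assms(1) unfolding tall_rel_def by blast
  have t: "x \<in> terms F" by (rule rank_le_terms[OF C(3)])
  obtain w where w: "pair_step\<^sup>*\<^sup>* (?C, y) (C, w)" "fills rsteps C z w"
    using fills_pair_steps_right[OF C(2) y] by auto
  have "y \<in> terms F" by (rule terms_rsteps[OF t fills_rsteps[OF y]])
  then have "base_rel k y w" using base_fills[OF C(1) t y] w(1) unfolding base_rel_def by blast
  moreover have "base_of k C z" "z \<in> terms F" using base_pair_steps[OF C(2) C(1) t] by auto
  ultimately show ?thesis using tall_transfer[OF _ _ w(2)] by blast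
qed

text \<open>The witness \<open>N\<close> is \<open>M\<close> with variables in the holes of the tall
  aliens. It shares the skeleton of \<open>M\<close>, hence is a layer, and leaves only short
  aliens.\<close>

lemma rank_le_fill:
  "fills (tall_cut k) M C x \<Longrightarrow> fills (\<lambda>u b. b = Var (h u)) C x D \<Longrightarrow> x \<in> terms F \<Longrightarrow>
    \<exists>N. subst (\<lambda>_. Hole) N = subst (\<lambda>_. Hole) M \<and> aliens (rank_le k) N D"
proof (induction arbitrary: D rule: fills.induct)
  case (hole c u)
  show ?case
  proof (cases "rank_le k u")
    case True
    then have "D = u" using hole by (simp add: fills_term)
    then show ?thesis using True by (intro exI[of _ Hole]) simp
  next
    case False
    then have "D = Var (h u)" using hole by simp
    then show ?thesis by (intro exI[of _ D]) simp
  qed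
next
  case (var y)
  then show ?case by (intro exI[of _ "Var y"]) simp
next
  case (app cs ms xs f)
  from app.prems(1) obtain ds where ds: "D = Fun f ds" "length ds = length ms"
    "\<And>i. i < length ms \<Longrightarrow> fills (\<lambda>u b. b = Var (h u)) (cs ! i) (xs ! i) (ds ! i)"
    by (rule fills_FunE) (use app.hyps in auto)
  have "xs ! i \<in> terms F" if "i < length ms" for i
    using app.prems(2) app.hyps that by (simp add: terms_Fun)
  then have "\<forall>i. \<exists>N. i < length ms \<longrightarrow>
      subst (\<lambda>_. Hole) N = subst (\<lambda>_. Hole) (ms ! i) \<and> aliens (rank_le k) N (ds ! i)"
    using app.IH ds(3) by blast
  from choice[OF this] obtain N where "\<And>i. i < length ms \<Longrightarrow>
      subst (\<lambda>_. Hole) (N i) = subst (\<lambda>_. Hole) (ms ! i) \<and> aliens (rank_le k) (N i) (ds ! i)" by blast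
  then show ?case
    using ds by (intro exI[of _ "Fun f (map N [0..<length ms])"]) (auto intro: nth_equalityI)
qed

lemma fill_terms: "fills (\<lambda>u b. b = Var (h u)) C x D \<Longrightarrow> x \<in> terms F \<Longrightarrow> D \<in> terms F"
proof (induction rule: fills.induct)
  case (app xs cs ds f)
  have "ds ! i \<in> terms F" if "i < length cs" for i
    using app that by (simp add: terms_Fun)
  then show ?case using app by (auto simp: terms_Fun in_set_conv_nth)
qed auto

lemma unfill:
  assumes "\<And>u. u \<in> S \<Longrightarrow> \<sigma> (h u) = u \<and> \<delta> (h u) = Hole"
  shows "aliens (\<lambda>u. u \<in> S) C x \<Longrightarrow> fills (\<lambda>u b. b = Var (h u)) C x D \<Longrightarrow>
    (\<And>y. y \<in> vars x \<Longrightarrow> \<sigma> y = Var y \<and> \<delta> y = Var y) \<Longrightarrow> subst \<sigma> D = x \<and> subst \<delta> D = C"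
proof (induction C arbitrary: x D)
  case Hole
  then show ?case using assms by auto
next
  case (Fun f cs)
  from Fun.prems(2) obtain xs ds where ds: "x = Fun f xs" "D = Fun f ds" "length xs = length cs"
    "length ds = length cs"
    "\<And>i. i < length cs \<Longrightarrow> fills (\<lambda>u b. b = Var (h u)) (cs ! i) (xs ! i) (ds ! i)"
    by (rule fills_FunE) auto
  have "subst \<sigma> (ds ! i) = xs ! i \<and> subst \<delta> (ds ! i) = cs ! i" if i: "i < length cs" for i
  proof (rule Fun.IH[OF nth_mem[OF i] _ ds(5)[OF i]])
    show "aliens (\<lambda>u. u \<in> S) (cs ! i) (xs ! i)" using Fun.prems(1) ds i by simp
    show "y \<in> vars (xs ! i) \<Longrightarrow> \<sigma> y = Var y \<and> \<delta> y = Var y" for y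
      by (rule Fun.prems(3)) (use ds(1,3) i nth_mem in auto)
  qed
  then show ?case using ds by (auto intro: nth_equalityI)
qed auto

text \<open>Cutting the tall aliens of \<open>x\<close> and plugging the holes with fresh variables, the same variable
  for equal aliens, gives a term of smaller rank to which confluence applies.\<close>

lemma base_base:
  assumes "confl (rank_le (Suc k))" "base_rel k x y" "base_rel k x z"
  shows "\<exists>w. base_rel k y w \<and> base_rel k z w"
proof -
  let ?C = "canon k x"
  obtain C1 where C1: "base_of k ?C x" "pair_step\<^sup>*\<^sup>* (?C, x) (C1, y)" "rank_le (Suc (Suc k)) x"
    using base_rel_canon[OF assms(2)] by blast
  obtain C2 where C2: "pair_step\<^sup>*\<^sup>* (?C, x) (C2, z)" using base_rel_canon[OF assms(3)] by blast
  have t: "x \<in> terms F" by (rule rank_le_terms[OF C1(3)])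
  obtain S where S: "finite S" "aliens (\<lambda>u. u \<in> S) ?C x"
    using pref_finite_aliens[OF base_pref[OF C1(1)]] by blast
  have "infinite (UNIV - vars x)" by (rule Diff_infinite_finite[OF finite_vars infinite_vars])
  from finite_inj_into_infinite[OF S(1) this]
  obtain h where h: "inj_on h S" "h ` S \<subseteq> UNIV - vars x" by blast
  have "\<exists>D. fills (\<lambda>u b. b = Var (h u)) ?C x D" by (rule fills_choice[OF _ S(2)]) blast
  then obtain D where D: "fills (\<lambda>u b. b = Var (h u)) ?C x D" ..
  \<comment> \<open>\<open>\<sigma>\<close> reinserts the aliens and \<open>\<delta>\<close> reopens
    the holes; on a common reduct of \<open>D1\<close> and \<open>D2\<close> they give the joining
    term and its base context.\<close>
  define \<sigma> where "\<sigma> v = (if v \<in> h ` S then inv_into S h v else Var v)" for v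
  define \<delta> :: "'v \<Rightarrow> ('f, 'v) mctxt" where "\<delta> v = (if v \<in> h ` S then Hole else Var v)" for v
  have "subst \<sigma> D = x \<and> subst \<delta> D = ?C"
    by (rule unfill[OF _ S(2) D]) (use h in \<open>auto simp: \<sigma>_def \<delta>_def\<close>)
  then have sD: "subst \<sigma> D = x" "subst \<delta> D = ?C" by auto
  obtain M where M: "mtop x M" "fills (tall_cut k) M ?C x"
    using canon[OF C1(3)] unfolding max_base_def by blast
  obtain N where N: "subst (\<lambda>_. Hole) N = subst (\<lambda>_. Hole) M" "aliens (rank_le k) N D"
    using rank_le_fill[OF M(2) D t] by blast
  have DF: "D \<in> terms F" by (rule fill_terms[OF D t])
  have "N \<in> contexts F" by (rule pref_contexts[OF fills_pref_left[OF N(2)] terms_contexts[OF DF]])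
  then have "N \<in> \<L>"
    using layer_skeleton[of N] layer_skeleton[of M] layer_contexts[of M] M(1) N(1)
    unfolding mtop_def by simp
  then have rank_le: "rank_le (Suc k) D" using N(2) DF unfolding rank_le.simps(2) by blast
  obtain D1 where D1: "rsteps D D1" "subst \<delta> D1 = C1" "subst \<sigma> D1 = y"
    using pair_steps_unsubst[OF C1(2) D sD(2,1)] by auto
  obtain D2 where D2: "rsteps D D2" "subst \<delta> D2 = C2" "subst \<sigma> D2 = z"
    using pair_steps_unsubst[OF C2 D sD(2,1)] by auto
  obtain W where W: "rsteps D1 W" "rsteps D2 W"
    using assms(1) rank_le D1(1) D2(1) unfolding confl_def by blast
  have "base_rel k y (subst \<sigma> W)"
    using base_pair_steps[OF C1(2,1) t] pair_steps_subst[OF W(1), of \<delta> \<sigma>] D1(2,3)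
    unfolding base_rel_def by auto
  moreover have "base_rel k z (subst \<sigma> W)"
    using base_pair_steps[OF C2 C1(1) t] pair_steps_subst[OF W(2), of \<delta> \<sigma>] D2(2,3)
    unfolding base_rel_def by auto
  ultimately show ?thesis by blast
qed

text \<open>The step takes place in an alien. If that is kept, the base context contains the same
  redex; if it is cut, the step is tall.\<close>

lemma step_split:
  "fills (tall_cut k) M C s \<Longrightarrow> rl \<in> R \<Longrightarrow> rstep_at p rl s t \<Longrightarrow> p \<notin> fun_poss M \<Longrightarrow> pref C s \<Longrightarrow>
    (\<exists>C'. rstep_at p rl C C') \<or> fills rsteps C s t"
proof (induction arbitrary: p t rule: fills.induct)
  case (hole c u)
  then show ?case by (cases "rank_le k u") (auto simp: rstep_def)
next
  case (var x)
  then show ?case using no_step_leaf by blast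
next
  case (app cs ms ss f)
  show ?case
  proof (cases p)
    case Nil
    then show ?thesis using app.prems(3) unfolding fun_poss_def by simp
  next
    case (Cons i q)
    then obtain u where i: "i < length ms" "rstep_at q rl (ss ! i) u" "t = Fun f (ss[i := u])"
      using app.prems(2) app.hyps by (auto simp: rstep_at_Cons)
    have "q \<notin> fun_poss (ms ! i)" using app.prems(3) i(1) unfolding fun_poss_def Cons by auto
    moreover have p: "pref (cs ! j) (ss ! j)" if "j < length ms" for j
      using app.prems(4) app.hyps that by simp
    ultimately consider C' where "rstep_at q rl (cs ! i) C'" | "fills rsteps (cs ! i) (ss ! i) u"
      using app.IH[OF i(1) app.prems(1) i(2)] i(1) by blast
    then show ?thesis
    proof cases
      case 1
      then show ?thesis using i(1) app.hyps unfolding Cons rstep_at_Cons by auto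
    next
      case 2
      have "fills rsteps (cs ! j) (ss ! j) (ss ! j)" if "j < length ms" for j
        by (rule fills_mono[OF p[OF that]]) simp
      then show ?thesis using 2 app.hyps i by (auto simp: nth_list_update)
    qed
  qed
qed

lemma step_tall_or_base:
  assumes "rank_le (Suc (Suc k)) s" "rstep R s t"
  shows "tall_rel k s t \<or> base_rel k s t"
proof -
  let ?C = "canon k s"
  note C = canon[OF assms(1)]
  have b: "base_of k ?C s" by (rule max_base_imp_base[OF C])
  have s: "s \<in> terms F" by (rule rank_le_terms[OF assms(1)])
  obtain M where M: "mtop s M" "fills (tall_cut k) M ?C s" using C unfolding max_base_def by blast
  obtain p rl where p: "rl \<in> R" "rstep_at p rl s t" using assms(2) unfolding rstep_def by blast
  have "(\<exists>C'. rstep_at p rl ?C C') \<or> fills rsteps ?C s t"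
  proof (cases "p \<in> fun_poss M")
    case True
    from mtop_step[OF M(1) p True] obtain N where "rstep_at p rl M N" by blast
    from rstep_at_fills[OF rules(1-4)[OF p(1)] M(2) this] show ?thesis by blast
  next
    case False
    show ?thesis by (rule step_split[OF M(2) p False base_pref[OF b]])
  qed
  then show ?thesis
  proof
    assume "\<exists>C'. rstep_at p rl ?C C'"
    then obtain C' where "rstep_at p rl ?C C'" ..
    then have "pair_step (?C, s) (C', t)" using p unfolding pair_step_def by auto
    then show ?thesis using s b unfolding base_rel_def by blast
  next
    assume "fills rsteps ?C s t"
    then show ?thesis using assms(1) unfolding tall_rel_def by blast
  qed
qed

text \<open>On terms of this rank, \<open>?S\<close> lies between one rewrite step and many, so its
  confluence carries over.\<close>

lemma confl_Suc:
  assumes "confl (rank_le (Suc k))"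
  shows "confl (rank_le (Suc (Suc k)))"
proof -
  let ?S = "tall_rel k OO (base_rel k)\<^sup>*\<^sup>*"
  have conf: "confluentp ?S"
    by (rule confluentp_tall_base[OF base_base[OF assms] tall_tall[OF assms] tall_base])
  have base: "rsteps x y" if "base_rel k x y" for x y
  proof -
    obtain B C where "pair_step\<^sup>*\<^sup>* (B, x) (C, y)" using \<open>base_rel k x y\<close> unfolding base_rel_def by blast
    from pair_steps_snd[OF this] show ?thesis by simp
  qed
  have bases: "rsteps x y" if "(base_rel k)\<^sup>*\<^sup>* x y" for x y
    using that by (induction rule: rtranclp_induct) (auto dest: base intro: rtranclp_trans)
  have S1: "rsteps x y" if "?S x y" for x y
  proof -
    obtain z where z: "tall_rel k x z" "(base_rel k)\<^sup>*\<^sup>* z y" using \<open>?S x y\<close> by blast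
    have "rsteps x z" using z(1) fills_rsteps[of "canon k x" x z] unfolding tall_rel_def by blast
    then show ?thesis using bases[OF z(2)] by (rule rtranclp_trans)
  qed
  have S: "rsteps x y" if "?S\<^sup>*\<^sup>* x y" for x y
    using that
  proof (induction rule: rtranclp_induct)
    case (step y z)
    show ?case by (rule rtranclp_trans[OF step.IH S1[OF step.hyps(2)]])
  qed simp
  \<comment> \<open>The empty tall step brings every base step into \<open>?S\<close>.\<close>
  have tall_refl: "tall_rel k s s" if "rank_le (Suc (Suc k)) s" for s
  proof -
    have "pref (canon k s) s" by (rule base_pref[OF max_base_imp_base[OF canon[OF that]]])
    then have "fills rsteps (canon k s) s s" by (rule fills_mono) simp
    then show ?thesis using that unfolding tall_rel_def by blast
  qed
  have one: "?S s t" if "rank_le (Suc (Suc k)) s" "rstep R s t" for s t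
    using step_tall_or_base[OF that] tall_refl[OF that(1)] by blast
  have steps: "?S\<^sup>*\<^sup>* s t" if "rank_le (Suc (Suc k)) s" "rsteps s t" for s t
    using that(2)
  proof (induction rule: rtranclp_induct)
    case (step t u)
    have "?S t u" by (rule one[OF rank_le_rsteps[OF that(1) step.hyps(1)] step.hyps(2)])
    with step.IH show ?case by (rule rtranclp.rtrancl_into_rtrancl)
  qed simp
  show ?thesis
    unfolding confl_def using steps S confluentpD[OF conf] by meson
qed

section \<open>Rank one and the final induction\<close>

lemma aliens_none: "aliens (\<lambda>_. False) L s \<Longrightarrow> L = s"
proof (induction L arbitrary: s)
  case (Fun f ls)
  then show ?case by (auto elim!: fills_FunE intro: nth_equalityI)
qed auto

text \<open>Nothing satisfies \<open>rank_le 0\<close>, so the witnessing layer leaves no aliens and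
  is the term itself.\<close>

lemma rank_le_1: "rank_le (Suc 0) s \<Longrightarrow> s \<in> \<L> \<inter> terms F"
  unfolding rank_le.simps(2) using aliens_none by (auto simp: rank_le.simps(1)[abs_def])

lemma confl_1:
  assumes "confluent_on (\<L> \<inter> terms F) (rstep R)"
  shows "confl (rank_le (Suc 0))"
proof -
  let ?S = "\<L> \<inter> terms F"
  let ?r = "\<lambda>s t. s \<in> ?S \<and> t \<in> ?S \<and> rstep R s t"
  have closed: "t \<in> ?S" if "s \<in> ?S" "rstep R s t" for s t
    using assms that unfolding confluent_on_def by blast
  have conf: "confluentp ?r" using assms unfolding confluent_on_def by blast
  have 1: "?r\<^sup>*\<^sup>* s t \<and> t \<in> ?S" if "s \<in> ?S" "rsteps s t" for s t
    using that(2)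
  proof (induction rule: rtranclp_induct)
    case base
    then show ?case using that(1) by blast
  next
    case (step t u)
    then have "?r t u" using closed by blast
    with step.IH show ?case
      using rtranclp.rtrancl_into_rtrancl[of ?r s t u] by blast
  qed
  have 2: "rsteps s t" if "?r\<^sup>*\<^sup>* s t" for s t
    using that by (rule rtranclp_mono[THEN predicate2D, rotated]) blast
  show ?thesis
    unfolding confl_def
  proof (intro allI impI)
    fix s t u assume s: "rank_le (Suc 0) s" "rsteps s t" "rsteps s u"
    from confluentpD[OF conf 1[OF rank_le_1[OF s(1)] s(2), THEN conjunct1]
        1[OF rank_le_1[OF s(1)] s(3), THEN conjunct1]]
    show "\<exists>w. rsteps t w \<and> rsteps u w" using 2 by blast
  qed
qed

lemma confl_rank_le:
  assumes "confluent_on (\<L> \<inter> terms F) (rstep R)"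
  shows "confl (rank_le (Suc k))"
  by (induction k) (rule confl_1[OF assms], erule confl_Suc)

lemma confluent_terms:
  assumes "confluent_on (\<L> \<inter> terms F) (rstep R)"
  shows "confluent_on (terms F) (rstep R)"
  unfolding confluent_on_def
proof (intro conjI allI impI confluentpI)
  show "t \<in> terms F" if "s \<in> terms F \<and> rstep R s t" for s t
    using that terms_rsteps[of s t] by blast
next
  let ?r = "\<lambda>s t. s \<in> terms F \<and> t \<in> terms F \<and> rstep R s t"
  fix s t u assume st: "?r\<^sup>*\<^sup>* s t" "?r\<^sup>*\<^sup>* s u"
  \<comment> \<open>A term outside \<open>terms F\<close> admits only the empty reduction; this is
    the first alternative.\<close>
  have 1: "rsteps s t \<and> (s = t \<or> s \<in> terms F)" if "?r\<^sup>*\<^sup>* s t" for s t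
    using that by (induction rule: converse_rtranclp_induct) auto
  have 2: "?r\<^sup>*\<^sup>* s t" if "s \<in> terms F" "rsteps s t" for s t
    using that(2)
  proof (induction rule: rtranclp_induct)
    case (step t u)
    have "t \<in> terms F" by (rule terms_rsteps[OF that(1) step.hyps(1)])
    moreover have "u \<in> terms F"
      by (rule terms_rsteps[OF that(1) rtranclp.rtrancl_into_rtrancl[OF step.hyps]])
    ultimately have "?r t u" using step.hyps(2) by blast
    with step.IH show ?case by (rule rtranclp.rtrancl_into_rtrancl)
  qed simp
  show "\<exists>w. ?r\<^sup>*\<^sup>* t w \<and> ?r\<^sup>*\<^sup>* u w"
  proof (cases "s \<in> terms F")
    case True
    then obtain n where n: "rank_le (Suc n) s" using rank_le_exists rank_le_SucI by blast
    have su: "rsteps s t" "rsteps s u" using 1 st by blast+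
    obtain w where w: "rsteps t w" "rsteps u w"
      using confl_rank_le[OF assms, of n] n su unfolding confl_def by blast
    have "t \<in> terms F" "u \<in> terms F" using terms_rsteps[OF True] su by blast+
    then show ?thesis using 2 w by blast
  next
    case False
    then have "s = t" "s = u" using 1 st by blast+
    then show ?thesis by blast
  qed
qed

end

theorem theorem4p1:
  fixes F :: "('f \<times> nat) set"
    and \<L> :: "('f, 'v :: countable) mctxt set"
    and R :: "('f, 'v) rule set"
  assumes "infinite (UNIV :: 'v set)"
    and "layer_system F \<L>"
    and "trs F R"
    and "weakly_layered F \<L> R"
    and "confluent_on (\<L> \<inter> terms F) (rstep R)"
    and "left_linear R"
  shows "confluent_on (terms F) (rstep R)"
proof -
  interpret layered F \<L> R using assms(1-4,6) by unfold_locales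
  show ?thesis by (rule confluent_terms[OF assms(5)])
qed

end
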